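(* Let $K_A$ and $K_B$ be state spaces, let $V$ be a finite-dimensional real vector space, and let $f:K_A\times K_B\to V$ be affine in each argument separately, identified with the linear map $f:A(K_A)^*\otimes A(K_B)^*\to V$ satisfying $f(x_A\otimes x_B)=f(x_A,x_B)$. The following are equivalent: (i) there exist $x_A\in K_A$, $x_B\in K_B$ with $f(x_A,x_B)=0$; (ii) there exist a bicompatible sequence $\{y_n\}_{n\in\mathbb{N}}$ and some $n\ge2$ such that $$(f\otimes \mathrm{id}^{\otimes(n-1)})(\mathcal{S}_n(y_n))=0,$$ where $f\otimes\mathrm{id}^{\otimes(n-1)}:(A(K_A)^*\otimes A(K_B)^* )^{\otimes n}\to V\otimes(A(K_A)^*\otimes A(K_B)^* )^{\otimes(n-1)}$ applies $f$ to the first factor $A(K_A)^*\otimes A(K_B)^*$ and the identity to the others. Moreover, if (i) holds then a bicompatible sequence satisfying the displayed equation for every $n\ge2$ exists.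
   Context: A state space is a compact convex subset $K$ of a finite-dimensional real vector space. $A(K)$ denotes the space of real-valued affine functions on $K$, $A(K)^+$ the affine functions nonnegative on $K$, $A(K)^*$ the dual of $A(K)$; each $x\in K$ is identified with the evaluation functional $g\mapsto g(x)$ in $A(K)^*$. $1_K$ is the constant function $1$ on $K$; $1_A=1_{K_A}$, $1_B=1_{K_B}$. For state spaces $K_1,\dots,K_r$, the maximal tensor product $K_1\hat\otimes\cdots\hat\otimes K_r$ is the set of $\varphi\in A(K_1)^*\otimes\cdots\otimes A(K_r)^*$ with $\varphi(g_1\otimes\cdots\otimes g_r)\ge0$ for all $g_i\in A(K_i)^+$ and $\varphi(1_{K_1}\otimes\cdots\otimes1_{K_r})=1$; $K^{\hat\otimes n}$ is the maximal tensor product of $n$ copies of $K$. A bicompatible sequence is a sequence $\{y_n\}_{n\in\mathbb{N}}$ with $y_n\in K_A^{\hat\otimes n}\hat\otimes K_B^{\hat\otimes n}$ such that (i) $y_{n-1}=(1_{A_n}\otimes 1_{B_n})(y_n)$ for $n\ge2$, where $1_{A_n}$ is the linear map $v_1\otimes\cdots\otimes v_n\mapsto 1_A(v_n)\,v_1\otimes\cdots\otimes v_{n-1}$ on the $A$-factors (identity on $B$-factors), and analogously $1_{B_n}$; (ii) $y_n=(S_{\sigma_A}\otimes S_{\sigma_B})(y_n)$ for all permutations $\sigma_A,\sigma_B$ of $\{1,\dots,n\}$, $S_\sigma$ being the linear map permuting the tensor factors. $\mathcal{S}_n:A(K_A)^{*\otimes n}\otimes A(K_B)^{*\otimes n}\to(A(K_A)^*\otimes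 A(K_B)^* )^{\otimes n}$ is the linear reordering isomorphism $(\otimes_{i=1}^n a_i)\otimes(\otimes_{i=1}^n b_i)\mapsto\otimes_{i=1}^n(a_i\otimes b_i)$. *)

theory Defs
  imports "HOL-Analysis.Analysis" "HOL-Combinatorics.Permutations"
begin

(* Real-valued affine functions on a convex set K, made extensional (zero off K),
   so that A(K) is represented faithfully as a set of functions. *)
definition affine_fun_on :: "'a::real_vector set \<Rightarrow> ('a \<Rightarrow> real) \<Rightarrow> bool" where
  "affine_fun_on K g \<longleftrightarrow>
     (\<forall>x\<in>K. \<forall>y\<in>K. \<forall>t::real. 0 \<le> t \<and> t \<le> 1 \<longrightarrow>
        g ((1 - t) *\<^sub>R x + t *\<^sub>R y) = (1 - t) * g x + t * g y)"

(* A(K) *)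
definition AK :: "'a::real_vector set \<Rightarrow> ('a \<Rightarrow> real) set" where
  "AK K = {g. affine_fun_on K g \<and> (\<forall>x. x \<notin> K \<longrightarrow> g x = 0)}"

(* A(K)^+ *)
definition AKp :: "'a::real_vector set \<Rightarrow> ('a \<Rightarrow> real) set" where
  "AKp K = {g \<in> AK K. \<forall>x\<in>K. 0 \<le> g x}"

(* 1_K *)
definition oneK :: "'a set \<Rightarrow> 'a \<Rightarrow> real" where
  "oneK K = (\<lambda>x. if x \<in> K then 1 else 0)"

(* Elements of A(K_A)^{*\<otimes>n} \<otimes> A(K_B)^{*\<otimes>n} are represented (finite dimension) as
   multilinear functionals Y gA gB on A(K_A)^n \<times> A(K_B)^n, where gA i, gB i (i < n)
   are the arguments in the i-th A-slot and i-th B-slot; Y(g_1..g_n, h_1..h_n)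
   = Y applied to g_1\<otimes>..\<otimes>g_n\<otimes>h_1\<otimes>..\<otimes>h_n.  Representatives are normalised:
   value 0 on invalid arguments, and dependence only on slots < n. *)
type_synonym ('a, 'b) tens = "(nat \<Rightarrow> 'a \<Rightarrow> real) \<Rightarrow> (nat \<Rightarrow> 'b \<Rightarrow> real) \<Rightarrow> real"

definition valid_args :: "'a::real_vector set \<Rightarrow> 'b::real_vector set \<Rightarrow> nat \<Rightarrow>
    (nat \<Rightarrow> 'a \<Rightarrow> real) \<Rightarrow> (nat \<Rightarrow> 'b \<Rightarrow> real) \<Rightarrow> bool" where
  "valid_args KA KB n gA gB \<longleftrightarrow> (\<forall>i<n. gA i \<in> AK KA \<and> gB i \<in> AK KB)"

definition tensor_space :: "'a::real_vector set \<Rightarrow> 'b::real_vector set \<Rightarrow> nat \<Rightarrow> ('a, 'b) tens set" where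
  "tensor_space KA KB n = {Y.
     (\<forall>gA gB. \<not> valid_args KA KB n gA gB \<longrightarrow> Y gA gB = 0) \<and>
     (\<forall>gA gB gA' gB'. (\<forall>i<n. gA i = gA' i \<and> gB i = gB' i) \<longrightarrow> Y gA gB = Y gA' gB') \<and>
     (\<forall>gA gB. valid_args KA KB n gA gB \<longrightarrow>
        (\<forall>i<n. \<forall>a\<in>AK KA. \<forall>a'\<in>AK KA. \<forall>c::real.
           Y (gA(i := (\<lambda>x. a x + c * a' x))) gB = Y (gA(i := a)) gB + c * Y (gA(i := a')) gB) \<and>
        (\<forall>i<n. \<forall>b\<in>AK KB. \<forall>b'\<in>AK KB. \<forall>c::real.
           Y gA (gB(i := (\<lambda>x. b x + c * b' x))) = Y gA (gB(i := b)) + c * Y gA (gB(i := b'))))}"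

(* K_A^{\<hat>\<otimes>n} \<hat>\<otimes> K_B^{\<hat>\<otimes>n}  (maximal tensor product of 2n factors) *)
definition max_tensor :: "'a::real_vector set \<Rightarrow> 'b::real_vector set \<Rightarrow> nat \<Rightarrow> ('a, 'b) tens set" where
  "max_tensor KA KB n = {Y \<in> tensor_space KA KB n.
     (\<forall>gA gB. (\<forall>i<n. gA i \<in> AKp KA \<and> gB i \<in> AKp KB) \<longrightarrow> 0 \<le> Y gA gB) \<and>
     Y (\<lambda>_. oneK KA) (\<lambda>_. oneK KB) = 1}"

(* bicompatible sequence (indexed by n \<ge> 1) *)
definition bicompatible :: "'a::real_vector set \<Rightarrow> 'b::real_vector set \<Rightarrow> (nat \<Rightarrow> ('a, 'b) tens) \<Rightarrow> bool" where
  "bicompatible KA KB y \<longleftrightarrow>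
     (\<forall>n\<ge>1. y n \<in> max_tensor KA KB n) \<and>
     (\<forall>n\<ge>2. \<forall>gA gB. valid_args KA KB (n - 1) gA gB \<longrightarrow>
        y (n - 1) gA gB = y n (gA(n - 1 := oneK KA)) (gB(n - 1 := oneK KB))) \<and>
     (\<forall>n\<ge>1. \<forall>\<sigma>A \<sigma>B. \<sigma>A permutes {..<n} \<and> \<sigma>B permutes {..<n} \<longrightarrow>
        (\<forall>gA gB. y n (gA \<circ> \<sigma>A) (gB \<circ> \<sigma>B) = y n gA gB))"

(* A(K_A)^dual \<otimes> A(K_B)^dual, as bilinear functionals on A(K_A) \<times> A(K_B) *)
definition bilin_forms :: "'a::real_vector set \<Rightarrow> 'b::real_vector set \<Rightarrow>
    (('a \<Rightarrow> real) \<Rightarrow> ('b \<Rightarrow> real) \<Rightarrow> real) set" where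
  "bilin_forms KA KB = {\<phi>.
     (\<forall>g h. \<not> (g \<in> AK KA \<and> h \<in> AK KB) \<longrightarrow> \<phi> g h = 0) \<and>
     (\<forall>h\<in>AK KB. \<forall>a\<in>AK KA. \<forall>a'\<in>AK KA. \<forall>c::real.
        \<phi> (\<lambda>x. a x + c * a' x) h = \<phi> a h + c * \<phi> a' h) \<and>
     (\<forall>g\<in>AK KA. \<forall>b\<in>AK KB. \<forall>b'\<in>AK KB. \<forall>c::real.
        \<phi> g (\<lambda>x. b x + c * b' x) = \<phi> g b + c * \<phi> g b')}"

(* linear map A(K_A)^dual \<otimes> A(K_B)^dual \<rightarrow> V *)
definition linear_on_forms :: "'a::real_vector set \<Rightarrow> 'b::real_vector set \<Rightarrow>
    ((('a \<Rightarrow> real) \<Rightarrow> ('b \<Rightarrow> real) \<Rightarrow> real) \<Rightarrow> 'v::real_vector) \<Rightarrow> bool" where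
  "linear_on_forms KA KB F \<longleftrightarrow>
     (\<forall>\<phi>\<in>bilin_forms KA KB. \<forall>\<psi>\<in>bilin_forms KA KB. \<forall>c::real.
        F (\<lambda>g h. \<phi> g h + c * \<psi> g h) = F \<phi> + c *\<^sub>R F \<psi>)"

(* x_A \<otimes> x_B (states as evaluation functionals) *)
definition ev_tensor :: "'a::real_vector set \<Rightarrow> 'b::real_vector set \<Rightarrow> 'a \<Rightarrow> 'b \<Rightarrow>
    ('a \<Rightarrow> real) \<Rightarrow> ('b \<Rightarrow> real) \<Rightarrow> real" where
  "ev_tensor KA KB x y = (\<lambda>g h. if g \<in> AK KA \<and> h \<in> AK KB then g x * h y else 0)"

(* reordering isomorphism S_n: an element of (A(K_A)^dual\<otimes>A(K_B)^dual)^(tensor n) is a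
   multilinear functional of n argument pairs p i = (g_i, h_i) *)
definition reorder_S :: "('a, 'b) tens \<Rightarrow>
    (nat \<Rightarrow> ('a \<Rightarrow> real) \<times> ('b \<Rightarrow> real)) \<Rightarrow> real" where
  "reorder_S Y = (\<lambda>p. Y (fst \<circ> p) (snd \<circ> p))"

(* f \<otimes> id^{\<otimes>(n-1)}: result in V \<otimes> (A(K_A)^dual\<otimes>A(K_B)^dual)^{\<otimes>(n-1)}, represented as a
   V-valued multilinear functional of the argument pairs in slots 1..n-1 *)
definition f_tensor_id :: "((('a \<Rightarrow> real) \<Rightarrow> ('b \<Rightarrow> real) \<Rightarrow> real) \<Rightarrow> 'v) \<Rightarrow>
    ((nat \<Rightarrow> ('a \<Rightarrow> real) \<times> ('b \<Rightarrow> real)) \<Rightarrow> real) \<Rightarrow>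
    (nat \<Rightarrow> ('a \<Rightarrow> real) \<times> ('b \<Rightarrow> real)) \<Rightarrow> 'v" where
  "f_tensor_id F Z = (\<lambda>p. F (\<lambda>g h. Z (p(0 := (g, h)))))"

end

theory Submission
  imports Defs
begin

text \<open>Contracting the equation in (ii) with \<open>f\<close> once more gives \<open>y\<^sub>2(\<bar>f\<bar>\<^sup>2) = 0\<close>. Hence it suffices to
  find product states on which \<open>\<bar>f\<bar>\<^sup>2\<close>, a form of bidegree (2, 2), is at most \<open>y\<^sub>2(\<bar>f\<bar>\<^sup>2) + \<epsilon>\<close>;
  compactness of \<open>K\<^sub>A \<times> K\<^sub>B\<close> then gives a zero of \<open>f\<close>. Observing \<open>a \<otimes> b\<close> on one further pair of
  subsystems turns a bicompatible sequence into another one, and observing \<open>a\<close> or its complement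
  \<open>1 - a\<close> writes the sequence as a convex combination of two such sequences. For a near-minimiser of
  \<open>\<bar>f\<bar>\<^sup>2\<close> minus a small multiple of the sum of squares of finitely many moments these decompositions
  are almost trivial, which means that its moments almost factorise: up to degree (2, 2) it is close
  to a product state, whose components are its barycentres in \<open>K\<^sub>A\<close> and \<open>K\<^sub>B\<close>. This replaces the
  appeal to extreme points in the proof of the de Finetti theorem.\<close>

section \<open>Affine functions on a convex body\<close>

lemma AK_lincomb:
  assumes "a \<in> AK K" "a' \<in> AK K"
  shows "(\<lambda>x. a x + c * a' x) \<in> AK K"
proof -
  have "a ((1 - t) *\<^sub>R x + t *\<^sub>R y) + c * a' ((1 - t) *\<^sub>R x + t *\<^sub>R y)
      = (1 - t) * (a x + c * a' x) + t * (a y + c * a' y)"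
    if "x \<in> K" "y \<in> K" "0 \<le> t" "t \<le> 1" for x y t
  proof -
    have "a ((1 - t) *\<^sub>R x + t *\<^sub>R y) = (1 - t) * a x + t * a y"
      "a' ((1 - t) *\<^sub>R x + t *\<^sub>R y) = (1 - t) * a' x + t * a' y"
      using assms that unfolding AK_def affine_fun_on_def by blast+
    then show ?thesis by (simp only:) (simp add: algebra_simps)
  qed
  then show ?thesis using assms unfolding AK_def affine_fun_on_def by simp
qed

lemma zero_in_AK: "(\<lambda>x. 0) \<in> AK K"
  by (auto simp: AK_def affine_fun_on_def)

lemma oneK_in_AK: "convex K \<Longrightarrow> oneK K \<in> AK K"
  by (auto simp: AK_def affine_fun_on_def oneK_def convex_alt)

lemma oneK_in_AKp: "convex K \<Longrightarrow> oneK K \<in> AKp K"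
  by (auto simp: AKp_def oneK_in_AK) (auto simp: oneK_def)

lemma AKp_complement:
  assumes "convex K" "a \<in> AK K" "\<And>x. x \<in> K \<Longrightarrow> a x \<le> 1"
  shows "(\<lambda>x. oneK K x + (-1) * a x) \<in> AKp K"
  using AK_lincomb[OF oneK_in_AK[OF assms(1)] assms(2), of "-1"] assms(3)
  unfolding AKp_def mem_Collect_eq by (auto simp: oneK_def)

lemma AK_sum:
  assumes "finite I" "\<And>i. i \<in> I \<Longrightarrow> u i \<in> AK K"
  shows "(\<lambda>x. \<Sum>i\<in>I. c i * u i x) \<in> AK K"
  using assms
proof (induction I rule: finite_induct)
  case empty
  then show ?case by (simp add: zero_in_AK)
next
  case (insert i I)
  then have "(\<lambda>x. (\<Sum>i\<in>I. c i * u i x) + c i * u i x) \<in> AK K"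
    by (intro AK_lincomb) auto
  then show ?case using insert by (simp add: add.commute)
qed

text \<open>Linearity is asked on A(K) only, since the functionals in use have default values
  elsewhere. The single equation covers additivity and, because it forces the value 0 at 0,
  homogeneity.\<close>

definition AK_linear :: "'a::real_vector set \<Rightarrow> (('a \<Rightarrow> real) \<Rightarrow> real) \<Rightarrow> bool" where
  "AK_linear K l \<longleftrightarrow> (\<forall>a\<in>AK K. \<forall>a'\<in>AK K. \<forall>c. l (\<lambda>x. a x + c * a' x) = l a + c * l a')"

lemma AK_linearD:
  "AK_linear K l \<Longrightarrow> a \<in> AK K \<Longrightarrow> a' \<in> AK K \<Longrightarrow> l (\<lambda>x. a x + c * a' x) = l a + c * l a'"
  unfolding AK_linear_def by blast

lemma AK_linear_zero: 
  assumes "AK_linear K l" shows "l (\<lambda>x. 0) = 0"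
  using AK_linearD[OF assms zero_in_AK zero_in_AK, of 1] by simp

lemma AK_linear_sum:
  assumes "AK_linear K l" "finite I" "\<And>i. i \<in> I \<Longrightarrow> u i \<in> AK K"
  shows "l (\<lambda>x. \<Sum>i\<in>I. c i * u i x) = (\<Sum>i\<in>I. c i * l (u i))"
  using assms(2,3)
proof (induction I rule: finite_induct)
  case empty
  then show ?case using AK_linear_zero[OF assms(1)] by simp
next
  case (insert i I)
  then have "l (\<lambda>x. (\<Sum>i\<in>I. c i * u i x) + c i * u i x) = l (\<lambda>x. \<Sum>i\<in>I. c i * u i x) + c i * l (u i)"
    by (intro AK_linearD[OF assms(1)] AK_sum) auto
  then show ?case using insert by (simp add: add.commute)
qed

text \<open>Affinity on \<open>K\<close> makes both \<open>g\<close> and \<open>- g\<close> convex,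
  so Jensen's inequality holds in both directions.\<close>

lemma affine_fun_on_convex_sum:
  fixes y :: "'i \<Rightarrow> 'a::real_vector"
  assumes "convex K" "affine_fun_on K g" "finite I" "sum w I = 1"
    "\<And>i. i \<in> I \<Longrightarrow> 0 \<le> w i" "\<And>i. i \<in> I \<Longrightarrow> y i \<in> K"
  shows "g (\<Sum>i\<in>I. w i *\<^sub>R y i) = (\<Sum>i\<in>I. w i * g (y i))"
proof -
  have eq: "g (u *\<^sub>R x + v *\<^sub>R z) = u * g x + v * g z"
    if "x \<in> K" "z \<in> K" "0 \<le> u" "0 \<le> v" "u + v = 1" for x z u v
  proof -
    have "u = 1 - v" "v \<le> 1" using that(3,5) by auto
    then show ?thesis using assms(2) that(1,2,4) unfolding affine_fun_on_def by blast
  qed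
  have cv: "convex_on K g" "convex_on K (\<lambda>x. - g x)"
    using assms(1) by (auto simp: convex_on_def eq)
  have ne: "I \<noteq> {}" using assms(4) by auto
  show ?thesis
    using convex_on_sum[OF assms(3) ne cv(1) assms(4), of y] convex_on_sum[OF assms(3) ne cv(2) assms(4), of y]
      assms(5,6) by (auto simp: sum_negf)
qed

text \<open>Affinity on \<open>K\<close> only speaks of convex combinations; separating the coefficients by sign
  turns an affine dependence into an equality of two convex combinations.\<close>

lemma affine_fun_on_dependence:
  fixes y :: "'i \<Rightarrow> 'a::real_vector"
  assumes "convex K" "affine_fun_on K g" "finite I" "sum r I = 0"
    "(\<Sum>i\<in>I. r i *\<^sub>R y i) = 0" "\<And>i. i \<in> I \<Longrightarrow> y i \<in> K"
  shows "(\<Sum>i\<in>I. r i * g (y i)) = 0"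
proof -
  define p where "p = (\<lambda>i. max (r i) 0)"
  define q where "q = (\<lambda>i. max (- r i) 0)"
  have r: "r i = p i - q i" and nn: "0 \<le> p i" "0 \<le> q i" for i by (auto simp: p_def q_def)
  define N where "N = sum p I"
  have Nq: "sum q I = N" using assms(4) by (simp add: r sum_subtractf N_def)
  show ?thesis
  proof (cases "N = 0")
    case True
    then have "\<forall>i\<in>I. p i = 0" "\<forall>i\<in>I. q i = 0"
      using Nq nn assms(3) by (auto simp: N_def sum_nonneg_eq_0_iff)
    then show ?thesis by (simp add: r)
  next
    case False
    then have N: "N > 0" using nn by (simp add: N_def sum_nonneg less_le)
    have "(\<Sum>i\<in>I. p i *\<^sub>R y i) = (\<Sum>i\<in>I. q i *\<^sub>R y i)"
      using assms(5) by (simp add: r scaleR_left_diff_distrib sum_subtractf)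
    then have "(1 / N) *\<^sub>R (\<Sum>i\<in>I. p i *\<^sub>R y i) = (1 / N) *\<^sub>R (\<Sum>i\<in>I. q i *\<^sub>R y i)" by simp
    then have pq: "(\<Sum>i\<in>I. (p i / N) *\<^sub>R y i) = (\<Sum>i\<in>I. (q i / N) *\<^sub>R y i)"
      by (simp add: scaleR_sum_right)
    have "g (\<Sum>i\<in>I. (p i / N) *\<^sub>R y i) = (\<Sum>i\<in>I. p i / N * g (y i))"
      using assms N nn by (intro affine_fun_on_convex_sum[of K]) (auto simp: N_def simp flip: sum_divide_distrib)
    moreover have "g (\<Sum>i\<in>I. (q i / N) *\<^sub>R y i) = (\<Sum>i\<in>I. q i / N * g (y i))"
      using assms N nn Nq by (intro affine_fun_on_convex_sum[of K]) (auto simp flip: sum_divide_distrib)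
    ultimately have "(\<Sum>i\<in>I. p i * g (y i)) / N = (\<Sum>i\<in>I. q i * g (y i)) / N"
      using pq by (simp add: sum_divide_distrib)
    then show ?thesis using N by (simp add: r left_diff_distrib sum_subtractf)
  qed
qed

text \<open>The coefficients \<open>r\<close> may be negative, so the representation of
  \<open>x\<close> is read as an affine dependence. The index \<open>None\<close> carries
  \<open>x\<close> with coefficient -1 and stays apart from the points of \<open>P\<close> even if
  \<open>x\<close> is one of them.\<close>

lemma affine_fun_on_affine_sum:
  fixes x :: "'a::real_vector"
  assumes "convex K" "affine_fun_on K g" "finite P" "P \<subseteq> K" "x \<in> K" "sum r P = 1"
    "(\<Sum>p\<in>P. r p *\<^sub>R p) = x"
  shows "g x = (\<Sum>p\<in>P. r p * g p)"
proof -
  define I where "I = insert None (Some ` P)"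
  define s where "s = (\<lambda>i. case i of None \<Rightarrow> - 1 | Some p \<Rightarrow> r p)"
  define y where "y = (\<lambda>i. case i of None \<Rightarrow> x | Some p \<Rightarrow> p)"
  have sum_I: "(\<Sum>i\<in>I. h i) = h None + (\<Sum>p\<in>P. h (Some p))" for h :: "'a option \<Rightarrow> 'c::comm_monoid_add"
    using assms(3) by (simp add: I_def sum.reindex)
  have "(\<Sum>i\<in>I. s i * g (y i)) = 0"
    using assms by (intro affine_fun_on_dependence[of K]) (auto simp: sum_I, auto simp: I_def s_def y_def)
  then show ?thesis by (simp add: sum_I s_def y_def)
qed

text \<open>Lifting \<open>x\<close> to \<open>(x, 1)\<close> turns affine dependence into linear
  dependence. A maximal independent set of lifted points of \<open>K\<close> gives \<open>P\<close>,
  and its coordinate functionals, restricted to \<open>K\<close>, give the functions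
  \<open>l p\<close>. Hence A(K) is determined by values on \<open>P\<close>.\<close>

lemma AK_dual_basis:
  fixes K :: "'a::euclidean_space set"
  assumes "convex K"
  obtains P and l :: "'a \<Rightarrow> 'a \<Rightarrow> real" where "finite P" "P \<subseteq> K" "\<And>p. p \<in> P \<Longrightarrow> l p \<in> AK K"
    "\<And>p. p \<in> P \<Longrightarrow> \<exists>c b. \<forall>x\<in>K. l p x = c + b \<bullet> x"
    "\<And>g. g \<in> AK K \<Longrightarrow> g = (\<lambda>x. \<Sum>p\<in>P. g p * l p x)"
proof -
  obtain B where B: "B \<subseteq> (\<lambda>x. (x, 1::real)) ` K" "independent B" "(\<lambda>x. (x, 1)) ` K \<subseteq> span B"
    using maximal_independent_subset by blast
  have finB: "finite B" using B(2) by (rule independent_imp_finite)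
  define P where "P = fst ` B"
  have P: "finite P" "P \<subseteq> K" using finB B(1) by (auto simp: P_def)
  have BP: "B = (\<lambda>x. (x, 1::real)) ` P" 
  proof -
    have "b = (fst b, 1)" if "b \<in> B" for b using B(1) that by auto
    then have "(\<lambda>x. (x, 1)) ` fst ` B = (\<lambda>b. b) ` B" unfolding image_image by (intro image_cong) auto
    then show ?thesis by (simp add: P_def)
  qed
  have "\<exists>h. linear h \<and> (\<forall>b'\<in>B. h b' = (if b' = b then 1 else 0::real))" for b
    by (rule linear_independent_extend[OF B(2)])
  then have "\<forall>b. \<exists>h. linear h \<and> (\<forall>b'\<in>B. h b' = (if b' = b then 1 else 0::real))" by (rule allI)
  from choice[OF this] obtain h where "\<forall>b. linear (h b) \<and> (\<forall>b'\<in>B. h b b' = (if b' = b then 1 else 0::real))" ..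
  then have h: "\<And>b. linear (h b)" "\<And>b b'. b' \<in> B \<Longrightarrow> h b b' = (if b' = b then 1 else 0::real)"
    by blast+
  define l where "l = (\<lambda>p x. if x \<in> K then h (p, 1) (x, 1) else 0)"
  have expand: "(\<Sum>p\<in>P. l p x *\<^sub>R p) = x \<and> (\<Sum>p\<in>P. l p x) = 1" if x: "x \<in> K" for x
  proof -
    have "(x, 1) \<in> span B" using B(3) x by auto
    then obtain r where r: "(x, 1) = (\<Sum>b\<in>B. r b *\<^sub>R b)" using span_finite[OF finB] by auto
    have "h b (x, 1) = r b" if "b \<in> B" for b
    proof -
      have "h b (x, 1) = (\<Sum>b'\<in>B. r b' * h b b')"
        by (simp add: r linear_sum[OF h(1)] linear_scale[OF h(1)])
      also have "\<dots> = (\<Sum>b'\<in>B. if b' = b then r b else 0)"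
        by (intro sum.cong) (auto simp: h(2))
      finally show ?thesis using that finB by simp
    qed
    then have "(x, 1) = (\<Sum>b\<in>B. h b (x, 1) *\<^sub>R b)" using r by simp
    also have "\<dots> = (\<Sum>p\<in>P. l p x *\<^sub>R (p, 1::real))"
      using x by (simp add: BP sum.reindex inj_on_def l_def)
    finally have eq: "(x, 1) = (\<Sum>p\<in>P. l p x *\<^sub>R (p, 1::real))" .
    show ?thesis using arg_cong[OF eq, of fst] arg_cong[OF eq, of snd]
      by (simp add: fst_sum snd_sum)
  qed
  have aff: "\<exists>c b. \<forall>x\<in>K. l p x = c + b \<bullet> x" for p
  proof -
    have "linear (h (p, 1) \<circ> (\<lambda>x. (x, 0)))"
      by (intro linear_compose h(1) linearI) auto
    then have lin: "linear (\<lambda>x. h (p, 1) (x, 0))" by (simp add: o_def)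
    \<comment> \<open>The Riesz representative of the linear part of the coordinate functional is
      its adjoint at 1.\<close>
    define b where "b = adjoint (\<lambda>x. h (p, 1) (x, 0)) 1"
    have b: "h (p, 1) (x, 0) = b \<bullet> x" for x
      using adjoint_works[OF lin, of x 1] unfolding b_def by (metis inner_commute inner_real_def mult.right_neutral)
    define c where "c = h (p, 1) (0, 1)"
    have "h (p, 1) (x, 1) = c + b \<bullet> x" for x
      using linear_add[OF h(1), of "(p, 1)" "(0, 1)" "(x, 0)"] unfolding b c_def
      by (simp only: add_Pair add_0_left add_0_right)
    then have "\<forall>x\<in>K. l p x = c + b \<bullet> x" unfolding l_def by simp
    then show ?thesis by blast
  qed
  have AK: "l p \<in> AK K" for p
  proof -
    obtain c b where cb: "\<forall>x\<in>K. l p x = c + b \<bullet> x" using aff by blast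
    have "l p ((1 - t) *\<^sub>R x + t *\<^sub>R y) = (1 - t) * l p x + t * l p y"
      if "x \<in> K" "y \<in> K" "0 \<le> t" "t \<le> 1" for x y t
    proof -
      have "(1 - t) *\<^sub>R x + t *\<^sub>R y \<in> K" using assms that by (simp add: convex_alt)
      then show ?thesis using cb that by (simp add: inner_add_right algebra_simps)
    qed
    then show ?thesis unfolding AK_def affine_fun_on_def by (auto simp: l_def)
  qed
  have "g = (\<lambda>x. \<Sum>p\<in>P. g p * l p x)" if g: "g \<in> AK K" for g
  proof
    fix x
    show "g x = (\<Sum>p\<in>P. g p * l p x)"
    proof (cases "x \<in> K")
      case True
      then have "g x = (\<Sum>p\<in>P. l p x * g p)"
        using g expand[OF True] P assms by (intro affine_fun_on_affine_sum[of K]) (auto simp: AK_def)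
      then show ?thesis by (simp add: mult.commute)
    next
      case False
      then show ?thesis using g by (simp add: AK_def l_def)
    qed
  qed
  then show ?thesis by (rule that[OF P AK aff])
qed

section \<open>Affine formulas, continuity and boundedness of elements of A(K)\<close>

lemma AK_eq_affine:
  fixes K :: "'a::euclidean_space set"
  assumes "convex K" "g \<in> AK K"
  obtains c b where "\<And>x. x \<in> K \<Longrightarrow> g x = c + b \<bullet> x"
proof -
  obtain P and l :: "'a \<Rightarrow> 'a \<Rightarrow> real" where "finite P" "P \<subseteq> K" "\<And>p. p \<in> P \<Longrightarrow> l p \<in> AK K"
    and l: "\<And>p. p \<in> P \<Longrightarrow> \<exists>c b. \<forall>x\<in>K. l p x = c + b \<bullet> x"
    and g: "\<And>g. g \<in> AK K \<Longrightarrow> g = (\<lambda>x. \<Sum>p\<in>P. g p * l p x)"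
    using AK_dual_basis[OF assms(1)] by blast
  obtain c b where cb: "\<And>p x. p \<in> P \<Longrightarrow> x \<in> K \<Longrightarrow> l p x = c p + b p \<bullet> x" using l by metis
  have "g x = (\<Sum>p\<in>P. g p * c p) + (\<Sum>p\<in>P. g p *\<^sub>R b p) \<bullet> x" if "x \<in> K" for x
    by (subst g[OF assms(2)]) (simp add: cb that distrib_left sum.distrib inner_sum_left)
  then show ?thesis using that by blast
qed

lemma AK_continuous_on:
  fixes K :: "'a::euclidean_space set"
  assumes "convex K" "g \<in> AK K"
  shows "continuous_on K g"
proof -
  obtain c b where cb: "\<And>x. x \<in> K \<Longrightarrow> g x = c + b \<bullet> x" using AK_eq_affine[OF assms] by blast
  have "continuous_on K (\<lambda>x. c + b \<bullet> x)" by (intro continuous_intros)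
  then show ?thesis by (simp add: cb cong: continuous_on_cong)
qed

lemma AK_bounded:
  fixes K :: "'a::euclidean_space set"
  assumes "compact K" "convex K" "g \<in> AK K"
  obtains C where "\<And>x. \<bar>g x\<bar> \<le> C" "C > 0"
proof -
  have "bounded (g ` K)"
    using compact_continuous_image[OF AK_continuous_on[OF assms(2,3)] assms(1)] by (rule compact_imp_bounded)
  then obtain C where "C > 0" "\<forall>x\<in>K. \<bar>g x\<bar> \<le> C" unfolding bounded_pos by auto
  moreover have "g x = 0" if "x \<notin> K" for x using assms(3) that by (simp add: AK_def)
  ultimately have "\<bar>g x\<bar> \<le> C" for x by (cases "x \<in> K") auto
  then show ?thesis using that \<open>C > 0\<close> by blast
qed

text \<open>The candidate is the barycentre of \<open>P\<close> with the weights
  \<open>s (l p)\<close>. If it lay outside \<open>K\<close>, a separating hyperplane would give an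
  affine function that is nonnegative on \<open>K\<close> but has a negative value under
  \<open>s\<close>.\<close>

lemma AK_state_eq_evaluation:
  fixes K :: "'a::euclidean_space set"
  assumes "compact K" "convex K" and lin: "AK_linear K s" and pos: "\<And>g. g \<in> AKp K \<Longrightarrow> 0 \<le> s g"
    and one: "s (oneK K) = 1"
  obtains x where "x \<in> K" "\<And>g. g \<in> AK K \<Longrightarrow> s g = g x"
proof -
  obtain P and l :: "'a \<Rightarrow> 'a \<Rightarrow> real" where P: "finite P" "P \<subseteq> K" and l: "\<And>p. p \<in> P \<Longrightarrow> l p \<in> AK K"
    and g: "\<And>g. g \<in> AK K \<Longrightarrow> g = (\<lambda>x. \<Sum>p\<in>P. g p * l p x)"
    using AK_dual_basis[OF assms(2)] by metis
  define x where "x = (\<Sum>p\<in>P. s (l p) *\<^sub>R p)"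
  have s: "s h = (\<Sum>p\<in>P. h p * s (l p))" if h: "h \<in> AK K" for h
    by (subst g[OF h]) (rule AK_linear_sum[OF lin P(1) l])
  have "(\<Sum>p\<in>P. oneK K p * s (l p)) = (\<Sum>p\<in>P. s (l p))"
    using P(2) by (intro sum.cong) (auto simp: oneK_def)
  then have sum1: "(\<Sum>p\<in>P. s (l p)) = 1" using s[OF oneK_in_AK[OF assms(2)]] one by simp
  \<comment> \<open>Stated with the formula \<open>c + b \<bullet> x\<close> and not with
    \<open>h x\<close>: membership of \<open>x\<close> in \<open>K\<close> is still open, and
    elements of A(K) are 0 off \<open>K\<close>.\<close>
  have affine: "s h = c + b \<bullet> x" if "h \<in> AK K" and h: "\<And>z. z \<in> K \<Longrightarrow> h z = c + b \<bullet> z" for h c b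
  proof -
    have "s h = (\<Sum>p\<in>P. (c + b \<bullet> p) * s (l p))"
      using s[OF that(1)] P(2) h by (auto intro!: sum.cong)
    also have "\<dots> = c * (\<Sum>p\<in>P. s (l p)) + b \<bullet> x"
      by (simp add: x_def sum.distrib sum_distrib_left inner_sum_right algebra_simps)
    finally show ?thesis using sum1 by simp
  qed
  have "x \<in> K"
  proof (rule ccontr)
    assume "x \<notin> K"
    then obtain b c where bc: "b \<bullet> x < c" "\<forall>z\<in>K. c < b \<bullet> z"
      using separating_hyperplane_closed_point[OF assms(2) compact_imp_closed[OF assms(1)]] by blast
    define h where "h = (\<lambda>z. if z \<in> K then - c + b \<bullet> z else 0)"
    have "h \<in> AK K" using assms(2)
      by (auto simp: AK_def affine_fun_on_def h_def convex_alt inner_add_right algebra_simps)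
    moreover have "h \<in> AKp K" using calculation bc by (auto simp: AKp_def h_def)
    ultimately show False using affine[of h "- c" b] pos[of h] bc(1) by (simp add: h_def)
  qed
  moreover have "s h = h x" if h: "h \<in> AK K" for h
  proof -
    obtain c b where "\<And>z. z \<in> K \<Longrightarrow> h z = c + b \<bullet> z" using AK_eq_affine[OF assms(2) h] by blast
    then show ?thesis using affine[OF h] \<open>x \<in> K\<close> by simp
  qed
  ultimately show ?thesis using that by blast
qed

text \<open>The bounds on the frame keep the probability of observing a frame element, and that of its
  complement, away from 0, so that one can condition on either outcome.\<close>

lemma AK_frame:
  fixes K :: "'a::euclidean_space set"
  assumes "compact K" "convex K"
  obtains E \<gamma> where "finite E" "E \<subseteq> AK K" "\<forall>e\<in>E. \<forall>x\<in>K. 1/4 \<le> e x \<and> e x \<le> 3/4"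
    "\<forall>e. AK_linear K (\<gamma> e)" "\<forall>g\<in>AK K. g = (\<lambda>x. \<Sum>e\<in>E. \<gamma> e g * e x)"
proof -
  obtain P and l :: "'a \<Rightarrow> 'a \<Rightarrow> real" where P: "finite P" "P \<subseteq> K" and l: "\<And>p. p \<in> P \<Longrightarrow> l p \<in> AK K"
    and g: "\<And>g. g \<in> AK K \<Longrightarrow> g = (\<lambda>x. \<Sum>p\<in>P. g p * l p x)"
    using AK_dual_basis[OF assms(2)] by metis
  have "\<exists>C. (\<forall>x. \<bar>l p x\<bar> \<le> C) \<and> C > 0" if "p \<in> P" for p using AK_bounded[OF assms l[OF that]] by metis
  then obtain C where C: "\<And>p x. p \<in> P \<Longrightarrow> \<bar>l p x\<bar> \<le> C p" "\<And>p. p \<in> P \<Longrightarrow> C p > 0" by metis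
  \<comment> \<open>This scale makes each \<open>c * l p\<close> at most 1/4 in absolute value, so
    adding 1/2 puts it between 1/4 and 3/4 on \<open>K\<close>. The summand 1 keeps the denominator
    positive when \<open>P\<close> is empty.\<close>
  define c where "c = 1 / (4 * (1 + sum C P))"
  have sC: "sum C P \<ge> 0" using C(2) by (force intro: sum_nonneg)
  then have c: "c > 0" by (simp add: c_def)
  have cl: "\<bar>c * l p x\<bar> \<le> 1/4" if "p \<in> P" for p x
  proof -
    have "C p \<le> sum C P" using that P(1) C(2) by (intro member_le_sum) (auto intro: less_imp_le)
    then have "\<bar>l p x\<bar> \<le> 1 + sum C P" using C(1)[OF that, of x] by linarith
    then have "c * \<bar>l p x\<bar> \<le> c * (1 + sum C P)" using c by simp
    also have "\<dots> = 1/4" using sC by (simp add: c_def field_simps)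
    finally show ?thesis using c by (simp add: abs_mult)
  qed
  define u where "u = (\<lambda>p x. 1/2 * oneK K x + c * l p x)"
  define N where "N = card P / 2 + c"
  have N: "N > 0" using c by (simp add: N_def add_nonneg_pos)
  \<comment> \<open>Inverts the definition of \<open>u\<close>: the functions \<open>u p\<close> sum
    to \<open>N\<close> times the unit, which expresses the unit, and then each \<open>l p\<close>,
    through the functions \<open>u p\<close>.\<close>
  define \<gamma> where "\<gamma> = (\<lambda>p (g::'a\<Rightarrow>real). g p / c - (\<Sum>q\<in>P. g q) / (2 * c * N))"
  have u: "u p \<in> AK K" if "p \<in> P" for p
    using AK_lincomb[OF AK_lincomb[OF zero_in_AK oneK_in_AK[OF assms(2)], of "1/2"] l[OF that], of c]
    by (simp add: u_def)
  have bounds: "1/4 \<le> u p x \<and> u p x \<le> 3/4" if "p \<in> P" "x \<in> K" for p x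
    using cl[OF that(1), of x] that(2) by (auto simp: u_def oneK_def abs_le_iff)
  have lin: "AK_linear K (\<gamma> p)" for p
    using c N by (simp add: AK_linear_def \<gamma>_def sum.distrib sum_distrib_left field_simps)
  have expand: "h = (\<lambda>x. \<Sum>p\<in>P. \<gamma> p h * u p x)" if h: "h \<in> AK K" for h
  proof
    fix x
    have "oneK K x = (\<Sum>p\<in>P. oneK K p * l p x)" using g[OF oneK_in_AK[OF assms(2)]] by metis
    also have "\<dots> = (\<Sum>p\<in>P. l p x)" using P(2) by (intro sum.cong) (auto simp: oneK_def)
    finally have one: "(\<Sum>p\<in>P. l p x) = oneK K x" ..
    have "(\<Sum>p\<in>P. u p x) = N * oneK K x"
      by (simp add: u_def sum.distrib N_def algebra_simps one flip: sum_distrib_left)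
    moreover have "(\<Sum>p\<in>P. h p * u p x) = 1/2 * oneK K x * sum h P + c * (\<Sum>p\<in>P. h p * l p x)"
      by (simp add: u_def sum.distrib sum_distrib_left algebra_simps)
    moreover have "h x = (\<Sum>p\<in>P. h p * l p x)" using g[OF h] by metis
    moreover have "(\<Sum>p\<in>P. \<gamma> p h * u p x)
        = (\<Sum>p\<in>P. h p * u p x) / c - sum h P / (2 * c * N) * (\<Sum>p\<in>P. u p x)"
      by (simp add: \<gamma>_def left_diff_distrib sum_subtractf sum_distrib_left sum_divide_distrib)
    ultimately show "h x = (\<Sum>p\<in>P. \<gamma> p h * u p x)" using c N by (simp add: field_simps)
  qed
  define \<gamma>' where "\<gamma>' = (\<lambda>e g. \<Sum>p | p \<in> P \<and> u p = e. \<gamma> p g)"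
  show ?thesis
  proof (rule that[of "u ` P" \<gamma>'])
    show "\<forall>e. AK_linear K (\<gamma>' e)"
      using lin by (simp add: AK_linear_def \<gamma>'_def sum.distrib sum_distrib_left)
    show "\<forall>h\<in>AK K. h = (\<lambda>x. \<Sum>e\<in>u ` P. \<gamma>' e h * e x)"
    proof
      fix h assume h: "h \<in> AK K"
      have "(\<Sum>e\<in>u ` P. \<gamma>' e h * e x) = (\<Sum>e\<in>u ` P. \<Sum>p | p \<in> P \<and> u p = e. \<gamma> p h * u p x)" for x
        by (simp add: \<gamma>'_def sum_distrib_right)
      also have "\<dots> x = (\<Sum>p\<in>P. \<gamma> p h * u p x)" for x
        using P(1) by (intro sum.group) auto
      finally show "h = (\<lambda>x. \<Sum>e\<in>u ` P. \<gamma>' e h * e x)" using expand[OF h] by simp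
    qed
  qed (use P u bounds in auto)
qed

section \<open>Conditioning bicompatible sequences\<close>

text \<open>The witness nearly minimises the linear functional \<open>c\<close> minus a small multiple of the squared
  norm; a convex decomposition lowers the average of this objective by its variance.\<close>

lemma near_extreme_point:
  fixes S :: "('m \<Rightarrow> real) set" and c :: "'m \<Rightarrow> real"
  assumes "finite M" and S0: "T0 \<in> S" and bound: "\<forall>T\<in>S. \<forall>m\<in>M. \<bar>T m\<bar> \<le> 1"
    and "\<kappa> > 0" "\<delta> > 0"
  obtains T where "T \<in> S" "(\<Sum>m\<in>M. c m * T m) \<le> (\<Sum>m\<in>M. c m * T0 m) + \<kappa>"
    "\<forall>T1\<in>S. \<forall>T2\<in>S. \<forall>\<alpha>. 0 \<le> \<alpha> \<longrightarrow> \<alpha> \<le> 1 \<longrightarrow>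
       (\<forall>m\<in>M. T m = \<alpha> * T1 m + (1 - \<alpha>) * T2 m) \<longrightarrow>
       (\<forall>m\<in>M. \<alpha> * (1 - \<alpha>) * (T1 m - T2 m)\<^sup>2 \<le> \<delta>)"
proof -
  \<comment> \<open>With this weight the quadratic penalty lies between 0 and
    \<open>\<kappa>\<close> on all of \<open>S\<close>.\<close>
  define \<eta> where "\<eta> = \<kappa> / (1 + card M)"
  have \<eta>: "\<eta> > 0" using assms(4) by (simp add: \<eta>_def)
  define J where "J = (\<lambda>T. (\<Sum>m\<in>M. c m * T m) - \<eta> * (\<Sum>m\<in>M. (T m)\<^sup>2))"
  have sq: "0 \<le> \<eta> * (\<Sum>m\<in>M. (T m)\<^sup>2) \<and> \<eta> * (\<Sum>m\<in>M. (T m)\<^sup>2) \<le> \<kappa>" if "T \<in> S" for T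
  proof -
    have "(\<Sum>m\<in>M. (T m)\<^sup>2) \<le> (\<Sum>m\<in>M. 1)"
      using bound that by (intro sum_mono) (simp add: abs_square_le_1)
    then have "\<eta> * (\<Sum>m\<in>M. (T m)\<^sup>2) \<le> \<eta> * (1 + card M)" using \<eta> by (intro mult_left_mono) auto
    also have "\<dots> = \<kappa>" by (simp add: \<eta>_def)
    finally show ?thesis using \<eta> by (simp add: sum_nonneg)
  qed
  have "bdd_below (J ` S)"
  proof (rule bdd_belowI2)
    fix T assume T: "T \<in> S"
    have "\<bar>c m * T m\<bar> \<le> \<bar>c m\<bar>" if "m \<in> M" for m
      using bound T that by (simp add: abs_mult mult_left_le)
    then have "\<bar>\<Sum>m\<in>M. c m * T m\<bar> \<le> (\<Sum>m\<in>M. \<bar>c m\<bar>)"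
      by (intro order_trans[OF sum_abs] sum_mono) auto
    then show "- (\<Sum>m\<in>M. \<bar>c m\<bar>) - \<kappa> \<le> J T" using sq[OF T] by (simp add: J_def abs_le_iff)
  qed
  then have lower: "Inf (J ` S) \<le> J T" if "T \<in> S" for T using that by (intro cInf_lower) auto
  have "\<exists>v\<in>J ` S. v < Inf (J ` S) + \<eta> * \<delta>"
    using S0 \<eta> assms(5) by (intro cInf_lessD) auto
  then obtain T' where T': "T' \<in> S" "J T' < Inf (J ` S) + \<eta> * \<delta>" by blast
  \<comment> \<open>The better of \<open>T0\<close> and the near-minimiser: it is within
    \<open>\<eta> * \<delta>\<close> of the infimum and also no worse than \<open>T0\<close>, which
    the first conclusion needs.\<close>
  define T where "T = (if J T0 \<le> J T' then T0 else T')"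
  have T: "T \<in> S" "J T < Inf (J ` S) + \<eta> * \<delta>" "J T \<le> J T0" using T' S0 by (auto simp: T_def)
  show ?thesis
  proof (rule that[OF T(1)])
    show "(\<Sum>m\<in>M. c m * T m) \<le> (\<Sum>m\<in>M. c m * T0 m) + \<kappa>"
      using T(3) sq[OF T(1)] sq[OF S0] by (simp add: J_def)
  next
    show "\<forall>T1\<in>S. \<forall>T2\<in>S. \<forall>\<alpha>. 0 \<le> \<alpha> \<longrightarrow> \<alpha> \<le> 1 \<longrightarrow>
       (\<forall>m\<in>M. T m = \<alpha> * T1 m + (1 - \<alpha>) * T2 m) \<longrightarrow>
       (\<forall>m\<in>M. \<alpha> * (1 - \<alpha>) * (T1 m - T2 m)\<^sup>2 \<le> \<delta>)"
    proof (intro ballI allI impI)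
      fix T1 T2 \<alpha> n
      assume h: "T1 \<in> S" "T2 \<in> S" "0 \<le> \<alpha>" "\<alpha> \<le> 1"
        and "\<forall>m\<in>M. T m = \<alpha> * T1 m + (1 - \<alpha>) * T2 m" and n: "n \<in> M"
      then have dec: "\<And>m. m \<in> M \<Longrightarrow> T m = \<alpha> * T1 m + (1 - \<alpha>) * T2 m" by blast
      have "(\<Sum>m\<in>M. c m * T m) = (\<Sum>m\<in>M. \<alpha> * (c m * T1 m) + (1 - \<alpha>) * (c m * T2 m))"
        by (intro sum.cong) (auto simp: dec algebra_simps)
      then have lin: "(\<Sum>m\<in>M. c m * T m) = \<alpha> * (\<Sum>m\<in>M. c m * T1 m) + (1 - \<alpha>) * (\<Sum>m\<in>M. c m * T2 m)"
        by (simp add: sum.distrib sum_distrib_left)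
      \<comment> \<open>The square of a mean is the mean of the squares minus the variance.\<close>
      have "(\<Sum>m\<in>M. (T m)\<^sup>2) = (\<Sum>m\<in>M. \<alpha> * (T1 m)\<^sup>2 + (1 - \<alpha>) * (T2 m)\<^sup>2 - \<alpha> * (1 - \<alpha>) * (T1 m - T2 m)\<^sup>2)"
        by (intro sum.cong) (auto simp: dec power2_eq_square algebra_simps)
      then have quad: "(\<Sum>m\<in>M. (T m)\<^sup>2) = \<alpha> * (\<Sum>m\<in>M. (T1 m)\<^sup>2) + (1 - \<alpha>) * (\<Sum>m\<in>M. (T2 m)\<^sup>2)
          - (\<Sum>m\<in>M. \<alpha> * (1 - \<alpha>) * (T1 m - T2 m)\<^sup>2)"
        by (simp add: sum.distrib sum_subtractf sum_distrib_left)
      define V where "V = (\<Sum>m\<in>M. \<alpha> * (1 - \<alpha>) * (T1 m - T2 m)\<^sup>2)"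
      \<comment> \<open>The objective at \<open>T\<close> exceeds the mean of its values at
        \<open>T1\<close> and \<open>T2\<close> by \<open>\<eta> * V\<close>. That mean is at least
        the infimum, and \<open>T\<close> is within \<open>\<eta> * \<delta>\<close> of it, so
        \<open>V\<close> is below \<open>\<delta>\<close>.\<close>
      have "J T = \<alpha> * J T1 + (1 - \<alpha>) * J T2 + \<eta> * V"
        unfolding J_def lin quad V_def by (simp add: algebra_simps)
      moreover have "\<alpha> * Inf (J ` S) + (1 - \<alpha>) * Inf (J ` S) \<le> \<alpha> * J T1 + (1 - \<alpha>) * J T2"
        using h lower by (intro add_mono mult_left_mono) auto
      ultimately have "\<eta> * V < \<eta> * \<delta>" using T(2) by (simp add: algebra_simps)
      then have "V < \<delta>" using \<eta> by simp
      moreover have "\<alpha> * (1 - \<alpha>) * (T1 n - T2 n)\<^sup>2 \<le> V"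
        unfolding V_def using h n assms(1)
        by (intro member_le_sum[of n M "\<lambda>m. \<alpha> * (1 - \<alpha>) * (T1 m - T2 m)\<^sup>2"]) auto
      ultimately show "\<alpha> * (1 - \<alpha>) * (T1 n - T2 n)\<^sup>2 \<le> \<delta>" by simp
    qed
  qed
qed

section \<open>Access rules, marginals and exchanges of slots\<close>

lemma bicompatibleD:
  assumes "bicompatible KA KB Y"
  shows "1 \<le> n \<Longrightarrow> Y n \<in> max_tensor KA KB n"
    and "2 \<le> n \<Longrightarrow> valid_args KA KB (n - 1) gA gB \<Longrightarrow>
      Y n (gA(n - 1 := oneK KA)) (gB(n - 1 := oneK KB)) = Y (n - 1) gA gB"
    and "1 \<le> n \<Longrightarrow> \<sigma>A permutes {..<n} \<Longrightarrow> \<sigma>B permutes {..<n} \<Longrightarrow> Y n (gA \<circ> \<sigma>A) (gB \<circ> \<sigma>B) = Y n gA gB"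
  using assms unfolding bicompatible_def by metis+

lemma max_tensorD:
  assumes "Y \<in> max_tensor KA KB n"
  shows "\<not> valid_args KA KB n gA gB \<Longrightarrow> Y gA gB = 0"
    and "(\<And>i. i < n \<Longrightarrow> gA i = gA' i) \<Longrightarrow> (\<And>i. i < n \<Longrightarrow> gB i = gB' i) \<Longrightarrow> Y gA gB = Y gA' gB'"
    and "valid_args KA KB n gA gB \<Longrightarrow> i < n \<Longrightarrow> AK_linear KA (\<lambda>a. Y (gA(i := a)) gB)"
    and "valid_args KA KB n gA gB \<Longrightarrow> i < n \<Longrightarrow> AK_linear KB (\<lambda>b. Y gA (gB(i := b)))"
    and "(\<And>i. i < n \<Longrightarrow> gA i \<in> AKp KA) \<Longrightarrow> (\<And>i. i < n \<Longrightarrow> gB i \<in> AKp KB) \<Longrightarrow> 0 \<le> Y gA gB"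
    and "Y (\<lambda>_. oneK KA) (\<lambda>_. oneK KB) = 1"
proof -
  have "\<forall>gA gB gA' gB'. (\<forall>i<n. gA i = gA' i \<and> gB i = gB' i) \<longrightarrow> Y gA gB = Y gA' gB'"
    using assms unfolding max_tensor_def tensor_space_def mem_Collect_eq by (elim conjE)
  from this[rule_format, of gA gA' gB gB']
  show "Y gA gB = Y gA' gB'" if "\<And>i. i < n \<Longrightarrow> gA i = gA' i" "\<And>i. i < n \<Longrightarrow> gB i = gB' i"
    using that by simp
  show "Y gA gB = 0" if "\<not> valid_args KA KB n gA gB"
    using assms that unfolding max_tensor_def tensor_space_def mem_Collect_eq by (elim conjE) simp
  show "AK_linear KA (\<lambda>a. Y (gA(i := a)) gB)" "AK_linear KB (\<lambda>b. Y gA (gB(i := b)))"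
    if "valid_args KA KB n gA gB" "i < n"
    using assms that unfolding max_tensor_def tensor_space_def mem_Collect_eq AK_linear_def
    by (elim conjE, simp)+
qed (use assms in \<open>simp_all add: max_tensor_def\<close>)

text \<open>Level 1 reads slot 0 alone, so constant families can stand for its single pair of
  arguments. With the unit put into one factor, these facts make the functional a state on the
  other.\<close>

lemma bicompatible_state:
  assumes "bicompatible KA KB Y" "convex KA" "convex KB"
  shows "b \<in> AK KB \<Longrightarrow> AK_linear KA (\<lambda>a. Y 1 (\<lambda>_. a) (\<lambda>_. b))"
    and "a \<in> AK KA \<Longrightarrow> AK_linear KB (\<lambda>b. Y 1 (\<lambda>_. a) (\<lambda>_. b))"
    and "a \<in> AKp KA \<Longrightarrow> b \<in> AKp KB \<Longrightarrow> 0 \<le> Y 1 (\<lambda>_. a) (\<lambda>_. b)"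
    and "Y 1 (\<lambda>_. oneK KA) (\<lambda>_. oneK KB) = 1"
proof -
  note Y1 = max_tensorD[OF bicompatibleD(1)[OF assms(1) order_refl]]
  show "AK_linear KA (\<lambda>a. Y 1 (\<lambda>_. a) (\<lambda>_. b))" if "b \<in> AK KB"
  proof -
    have "AK_linear KA (\<lambda>a. Y 1 ((\<lambda>_. oneK KA)(0 := a)) (\<lambda>_. b))"
      using that assms by (intro Y1(3)) (auto simp: valid_args_def oneK_in_AK)
    moreover have "Y 1 ((\<lambda>_. oneK KA)(0 := a)) (\<lambda>_. b) = Y 1 (\<lambda>_. a) (\<lambda>_. b)" for a
      by (intro Y1(2)) auto
    ultimately show ?thesis by simp
  qed
  show "AK_linear KB (\<lambda>b. Y 1 (\<lambda>_. a) (\<lambda>_. b))" if "a \<in> AK KA"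
  proof -
    have "AK_linear KB (\<lambda>b. Y 1 (\<lambda>_. a) ((\<lambda>_. oneK KB)(0 := b)))"
      using that assms by (intro Y1(4)) (auto simp: valid_args_def oneK_in_AK)
    moreover have "Y 1 (\<lambda>_. a) ((\<lambda>_. oneK KB)(0 := b)) = Y 1 (\<lambda>_. a) (\<lambda>_. b)" for b
      by (intro Y1(2)) auto
    ultimately show ?thesis by simp
  qed
  show "0 \<le> Y 1 (\<lambda>_. a) (\<lambda>_. b)" if "a \<in> AKp KA" "b \<in> AKp KB"
    using that by (intro Y1(5)) auto
  show "Y 1 (\<lambda>_. oneK KA) (\<lambda>_. oneK KB) = 1" by (rule Y1(6))
qed

lemma fun_upd_comp_transpose:
  "i \<noteq> j \<Longrightarrow> (g(i := a, j := a')) \<circ> Transposition.transpose i j = g(i := a', j := a)"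
  by (auto simp: fun_eq_iff Transposition.transpose_def)

lemma fun_upd_comp_permutes:
  assumes "\<sigma> permutes S" "n \<notin> S"
  shows "(g(n := x)) \<circ> \<sigma> = (g \<circ> \<sigma>)(n := x)"
proof -
  have "\<sigma> n = n" using assms by (simp add: permutes_def)
  then have "\<sigma> i = n \<longleftrightarrow> i = n" for i using permutes_inj[OF assms(1)] by (metis injD)
  then show ?thesis by (auto simp: fun_eq_iff)
qed

text \<open>The two permutations act independently: a transposition on one side goes with the
  identity on the other. This is what allows effects from different pairs to be recombined.\<close>

lemma bicompatible_swap:
  assumes Y: "bicompatible KA KB Y" and ij: "i < n" "j < n" "i \<noteq> j"
  shows "Y n (gA(i := a, j := a')) gB = Y n (gA(i := a', j := a)) gB"
    and "Y n gA (gB(i := b, j := b')) = Y n gA (gB(i := b', j := b))"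
proof -
  have \<sigma>: "Transposition.transpose i j permutes {..<n}"
    using ij by (intro permutes_swap_id) auto
  have n: "1 \<le> n" using ij by auto
  show "Y n (gA(i := a, j := a')) gB = Y n (gA(i := a', j := a)) gB"
    using bicompatibleD(3)[OF Y n \<sigma> permutes_id, of "gA(i := a, j := a')" gB]
    unfolding fun_upd_comp_transpose[OF ij(3)] by simp
  show "Y n gA (gB(i := b, j := b')) = Y n gA (gB(i := b', j := b))"
    using bicompatibleD(3)[OF Y n permutes_id \<sigma>, of gA "gB(i := b, j := b')"]
    unfolding fun_upd_comp_transpose[OF ij(3)] by simp
qed

text \<open>The sequence obtained by observing the effect \<open>a \<otimes> b\<close> on one extra pair of subsystems; the
  divisor is the probability of this outcome, and the value is junk if that is 0.\<close>

definition condition :: "(nat \<Rightarrow> ('a, 'b) tens) \<Rightarrow> ('a \<Rightarrow> real) \<Rightarrow> ('b \<Rightarrow> real) \<Rightarrow> nat \<Rightarrow> ('a, 'b) tens" where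
  "condition Y a b n = (\<lambda>gA gB. Y (Suc n) (gA(n := a)) (gB(n := b)) / Y 1 (\<lambda>_. a) (\<lambda>_. b))"

text \<open>Compatibility discards only the last slot. The effects are therefore first exchanged
  with the units in the slot before, and then the last pair of units is dropped.\<close>

lemma bicompatible_marginal_one:
  assumes Y: "bicompatible KA KB Y" and cv: "convex KA" "convex KB" and ab: "a \<in> AK KA" "b \<in> AK KB"
  shows "Y (Suc n) ((\<lambda>_. oneK KA)(n := a)) ((\<lambda>_. oneK KB)(n := b)) = Y 1 (\<lambda>_. a) (\<lambda>_. b)"
proof (induction n)
  case 0
  show ?case unfolding One_nat_def
    by (rule max_tensorD(2)[OF bicompatibleD(1)[OF Y, of "Suc 0"]]) auto
next
  case (Suc n)
  let ?A = "(\<lambda>_::nat. oneK KA)" and ?B = "(\<lambda>_::nat. oneK KB)"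
  have "Y (Suc (Suc n)) (?A(Suc n := a)) (?B(Suc n := b))
      = Y (Suc (Suc n)) (?A(n := oneK KA, Suc n := a)) (?B(n := oneK KB, Suc n := b))"
    by (simp add: fun_upd_idem)
  also have "\<dots> = Y (Suc (Suc n)) (?A(n := a, Suc n := oneK KA)) (?B(n := oneK KB, Suc n := b))"
    by (rule bicompatible_swap(1)[OF Y]) auto
  also have "\<dots> = Y (Suc (Suc n)) (?A(n := a, Suc n := oneK KA)) (?B(n := b, Suc n := oneK KB))"
    by (rule bicompatible_swap(2)[OF Y]) auto
  also have "\<dots> = Y (Suc n) (?A(n := a)) (?B(n := b))"
    using bicompatibleD(2)[OF Y, of "Suc (Suc n)" "?A(n := a)" "?B(n := b)"] cv ab
    by (simp add: valid_args_def oneK_in_AK)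
  also have "\<dots> = Y 1 (\<lambda>_. a) (\<lambda>_. b)" by (rule Suc.IH)
  finally show ?case .
qed

lemma valid_args_Suc_upd:
  "valid_args KA KB (Suc n) (gA(n := a)) (gB(n := b)) \<longleftrightarrow>
    valid_args KA KB n gA gB \<and> a \<in> AK KA \<and> b \<in> AK KB"
  unfolding valid_args_def by (auto simp: less_Suc_eq)

text \<open>Filling the extra slot with positive effects keeps positivity, and the divisor is the
  value at the units by \<open>bicompatible_marginal_one\<close>. Compatibility and symmetry are
  inherited one level up.\<close>

lemma bicompatible_condition:
  assumes Y: "bicompatible KA KB Y" and cv: "convex KA" "convex KB"
    and ab: "a \<in> AKp KA" "b \<in> AKp KB" and pos: "Y 1 (\<lambda>_. a) (\<lambda>_. b) > 0"
  shows "bicompatible KA KB (condition Y a b)"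
proof -
  have AK: "a \<in> AK KA" "b \<in> AK KB" using ab by (auto simp: AKp_def)
  define p where "p = Y 1 (\<lambda>_. a) (\<lambda>_. b)"
  note c = condition_def[of Y a b, folded p_def]
  note Ymax = max_tensorD[OF bicompatibleD(1)[OF Y]]
  have max: "condition Y a b n \<in> max_tensor KA KB n" for n
  proof -
    note M = Ymax[of "Suc n"]
    have "condition Y a b n \<in> tensor_space KA KB n"
      unfolding tensor_space_def mem_Collect_eq
    proof (intro conjI allI impI ballI)
      fix gA gB assume "\<not> valid_args KA KB n gA gB"
      then show "condition Y a b n gA gB = 0"
        by (simp add: c M(1) valid_args_Suc_upd)
    next
      fix gA gA' :: "nat \<Rightarrow> 'a \<Rightarrow> real" and gB gB' :: "nat \<Rightarrow> 'b \<Rightarrow> real"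
      assume "\<forall>i<n. gA i = gA' i \<and> gB i = gB' i"
      then have "Y (Suc n) (gA(n := a)) (gB(n := b)) = Y (Suc n) (gA'(n := a)) (gB'(n := b))"
        by (intro M(2)) auto
      then show "condition Y a b n gA gB = condition Y a b n gA' gB'" by (simp add: c)
    next
      fix gA gB i g g' and r :: real
      assume v: "valid_args KA KB n gA gB" "i < n" "g \<in> AK KA" "g' \<in> AK KA"
      have "AK_linear KA (\<lambda>g. Y (Suc n) ((gA(n := a))(i := g)) (gB(n := b)))"
        using v AK by (intro M(3)) (auto simp: valid_args_Suc_upd)
      from AK_linearD[OF this v(3,4), of r] v(2)
      show "condition Y a b n (gA(i := \<lambda>x. g x + r * g' x)) gB =
          condition Y a b n (gA(i := g)) gB + r * condition Y a b n (gA(i := g')) gB"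
        by (simp add: c fun_upd_twist[of n i] add_divide_distrib)
    next
      fix gA gB i g g' and r :: real
      assume v: "valid_args KA KB n gA gB" "i < n" "g \<in> AK KB" "g' \<in> AK KB"
      have "AK_linear KB (\<lambda>g. Y (Suc n) (gA(n := a)) ((gB(n := b))(i := g)))"
        using v AK by (intro M(4)) (auto simp: valid_args_Suc_upd)
      from AK_linearD[OF this v(3,4), of r] v(2)
      show "condition Y a b n gA (gB(i := \<lambda>x. g x + r * g' x)) =
          condition Y a b n gA (gB(i := g)) + r * condition Y a b n gA (gB(i := g'))"
        by (simp add: c fun_upd_twist[of n i] add_divide_distrib)
    qed
    moreover have "0 \<le> condition Y a b n gA gB" if "\<forall>i<n. gA i \<in> AKp KA \<and> gB i \<in> AKp KB" for gA gB
    proof -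
      have "0 \<le> Y (Suc n) (gA(n := a)) (gB(n := b))" using that ab by (intro M(5)) auto
      then show ?thesis using pos by (simp add: condition_def)
    qed
    moreover have "condition Y a b n (\<lambda>_. oneK KA) (\<lambda>_. oneK KB) = 1"
      using bicompatible_marginal_one[OF Y cv AK] pos by (simp add: condition_def)
    ultimately show ?thesis unfolding max_tensor_def by blast
  qed
  moreover have "condition Y a b (n - 1) gA gB = condition Y a b n (gA(n - 1 := oneK KA)) (gB(n - 1 := oneK KB))"
    if n: "n \<ge> 2" and v: "valid_args KA KB (n - 1) gA gB" for n gA gB
  proof -
    \<comment> \<open>The units to be discarded sit in slot \<open>k\<close>, while the last slot
      \<open>n\<close> holds the effects; two exchanges bring the units to the end.\<close>
    obtain k where k: "n = Suc k" using n by (cases n) auto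
    have "Y (Suc n) (gA(k := oneK KA, n := a)) (gB(k := oneK KB, n := b))
        = Y (Suc n) (gA(k := a, n := oneK KA)) (gB(k := oneK KB, n := b))"
      by (rule bicompatible_swap(1)[OF Y]) (auto simp: k)
    also have "\<dots> = Y (Suc n) (gA(k := a, n := oneK KA)) (gB(k := b, n := oneK KB))"
      by (rule bicompatible_swap(2)[OF Y]) (auto simp: k)
    also have "\<dots> = Y n (gA(k := a)) (gB(k := b))"
      using bicompatibleD(2)[OF Y, of "Suc n" "gA(k := a)" "gB(k := b)"] v AK k n
      by (simp add: valid_args_Suc_upd)
    finally show ?thesis by (simp add: c k)
  qed
  moreover have "condition Y a b n (gA \<circ> \<sigma>A) (gB \<circ> \<sigma>B) = condition Y a b n gA gB"
    if \<sigma>: "\<sigma>A permutes {..<n}" "\<sigma>B permutes {..<n}" for n \<sigma>A \<sigma>B gA gB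
  proof -
    \<comment> \<open>A permutation of the first \<open>n\<close> slots is one of the first
      \<open>Suc n\<close> slots that fixes the slot of the effects.\<close>
    have "{..<n} \<subseteq> {..<Suc n}" by auto
    then show ?thesis using \<sigma> bicompatibleD(3)[OF Y, of "Suc n" \<sigma>A \<sigma>B]
      by (simp add: c permutes_subset flip: fun_upd_comp_permutes[of _ "{..<n}"])
  qed
  ultimately show ?thesis unfolding bicompatible_def by blast
qed

section \<open>Approximate factorisation of moments\<close>

definition two :: "('c \<Rightarrow> real) \<Rightarrow> ('c \<Rightarrow> real) \<Rightarrow> nat \<Rightarrow> 'c \<Rightarrow> real" where
  "two a a' = (\<lambda>_ _. 0)(0 := a, 1 := a')"

lemma two_upd_0: "(two a a')(0 := a'') = two a'' a'"
  by (auto simp: two_def)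

text \<open>Moments of bidegree (2, 2). The arguments are grouped by pairs, as the reordering
  isomorphism does, with \<open>p\<close> in slot 0 and \<open>q\<close> in slot 1.\<close>

definition mom :: "(nat \<Rightarrow> ('a, 'b) tens) \<Rightarrow> ('a \<Rightarrow> real) \<times> ('b \<Rightarrow> real) \<Rightarrow> ('a \<Rightarrow> real) \<times> ('b \<Rightarrow> real) \<Rightarrow> real" where
  "mom Y p q = Y 2 (two (fst p) (fst q)) (two (snd p) (snd q))"

text \<open>The effect \<open>r\<close> comes first in the notation but sits in the last slot, where
  conditioning takes place.\<close>

definition mom3 :: "(nat \<Rightarrow> ('a, 'b) tens) \<Rightarrow> ('a \<Rightarrow> real) \<times> ('b \<Rightarrow> real) \<Rightarrow> ('a \<Rightarrow> real) \<times> ('b \<Rightarrow> real)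
    \<Rightarrow> ('a \<Rightarrow> real) \<times> ('b \<Rightarrow> real) \<Rightarrow> real" where
  "mom3 Y r p q = Y 3 ((two (fst p) (fst q))(2 := fst r)) ((two (snd p) (snd q))(2 := snd r))"

lemma mom_condition: "mom (condition Y a b) p q = mom3 Y (a, b) p q / Y 1 (\<lambda>_. a) (\<lambda>_. b)"
  by (simp add: mom_def mom3_def condition_def)

lemma valid_args_two:
  "valid_args KA KB 2 (two a a') (two b b') \<longleftrightarrow> a \<in> AK KA \<and> a' \<in> AK KA \<and> b \<in> AK KB \<and> b' \<in> AK KB"
  by (auto simp: valid_args_def two_def less_2_cases_iff)

lemma valid_args_three:
  "valid_args KA KB 3 ((two a a')(2 := a'')) ((two b b')(2 := b'')) \<longleftrightarrow>
    (a \<in> AK KA \<and> a' \<in> AK KA \<and> b \<in> AK KB \<and> b' \<in> AK KB) \<and> a'' \<in> AK KA \<and> b'' \<in> AK KB"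
  using valid_args_Suc_upd[of KA KB 2 "two a a'" a'' "two b b'" b''] by (simp add: valid_args_two)

context
  fixes KA :: "'a::real_vector set" and KB :: "'b::real_vector set" and Y :: "nat \<Rightarrow> ('a, 'b) tens"
  assumes Y: "bicompatible KA KB Y" and cv: "convex KA" "convex KB"
begin

lemma mom_eq_mom3:
  assumes "p \<in> AK KA \<times> AK KB" "q \<in> AK KA \<times> AK KB"
  shows "mom Y p q = mom3 Y (oneK KA, oneK KB) p q"
proof -
  have "valid_args KA KB (3 - 1) (two (fst p) (fst q)) (two (snd p) (snd q))"
    using assms by (auto simp: valid_args_two)
  from bicompatibleD(2)[OF Y _ this] show ?thesis by (simp add: mom_def mom3_def)
qed

text \<open>These exchanges move the factor that is to be split off into slot 2, the slot on which
  the sequence is conditioned.\<close>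

lemma mom3_swap:
  "mom3 Y (a2, b2) (a0, b0) (a1, b1) = mom3 Y (a0, b2) (a2, b0) (a1, b1)"
  "mom3 Y (a2, b2) (a0, b0) (a1, b1) = mom3 Y (a1, b2) (a0, b0) (a2, b1)"
  "mom3 Y (a2, b2) (a0, b0) (a1, b1) = mom3 Y (a2, b0) (a0, b2) (a1, b1)"
proof -
  \<comment> \<open>The two orders of updates place slot 0 or slot 1 next to slot 2, as
    \<open>bicompatible_swap\<close> requires.\<close>
  have e: "(two x y)(2 := z) = (\<lambda>_ _. 0)(1 := y, 0 := x, 2 := z)" "(two x y)(2 := z) = (\<lambda>_ _. 0)(0 := x, 1 := y, 2 := z)"
    for x y z :: "'c \<Rightarrow> real"
    by (auto simp: two_def fun_eq_iff)
  show "mom3 Y (a2, b2) (a0, b0) (a1, b1) = mom3 Y (a0, b2) (a2, b0) (a1, b1)"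
    unfolding mom3_def fst_conv snd_conv
    by (subst (1 2) e(1)) (rule bicompatible_swap(1)[OF Y], auto)
  show "mom3 Y (a2, b2) (a0, b0) (a1, b1) = mom3 Y (a1, b2) (a0, b0) (a2, b1)"
    unfolding mom3_def fst_conv snd_conv e(2)
    by (rule bicompatible_swap(1)[OF Y]) auto
  show "mom3 Y (a2, b2) (a0, b0) (a1, b1) = mom3 Y (a2, b0) (a0, b2) (a1, b1)"
    unfolding mom3_def fst_conv snd_conv e(1)
    by (rule bicompatible_swap(2)[OF Y]) auto
qed

section \<open>Marginals, linearity and bounds of moments\<close>

lemma mom_marginal:
  assumes "b \<in> AK KB"
  shows "mom Y (oneK KA, oneK KB) (oneK KA, b) = Y 1 (\<lambda>_. oneK KA) (\<lambda>_. b)"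
proof -
  have "mom Y (oneK KA, oneK KB) (oneK KA, b) = Y (Suc 1) ((\<lambda>_. oneK KA)(1 := oneK KA)) ((\<lambda>_. oneK KB)(1 := b))"
    unfolding mom_def fst_conv snd_conv Suc_1
    by (rule max_tensorD(2)[OF bicompatibleD(1)[OF Y, of 2]]) (auto simp: two_def)
  then show ?thesis using bicompatible_marginal_one[OF Y cv oneK_in_AK[OF cv(1)] assms, of 1] by simp
qed

lemma mom3_linear:
  assumes "p \<in> AK KA \<times> AK KB" "q \<in> AK KA \<times> AK KB"
  shows "b \<in> AK KB \<Longrightarrow> AK_linear KA (\<lambda>a. mom3 Y (a, b) p q)"
    and "a \<in> AK KA \<Longrightarrow> AK_linear KB (\<lambda>b. mom3 Y (a, b) p q)"
proof -
  note M = max_tensorD[OF bicompatibleD(1)[OF Y, of 3]]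
  have v: "valid_args KA KB 3 ((two (fst p) (fst q))(2 := a)) ((two (snd p) (snd q))(2 := b))"
    if "a \<in> AK KA" "b \<in> AK KB" for a b
    using that assms by (auto simp: valid_args_three)
  show "AK_linear KA (\<lambda>a. mom3 Y (a, b) p q)" if "b \<in> AK KB"
    using M(3)[OF _ v[OF oneK_in_AK[OF cv(1)] that], of 2] by (simp add: mom3_def)
  show "AK_linear KB (\<lambda>b. mom3 Y (a, b) p q)" if "a \<in> AK KA"
    using M(4)[OF _ v[OF that oneK_in_AK[OF cv(2)]], of 2] by (simp add: mom3_def)
qed

text \<open>The difference of the two sides is the value with the complement of the effect in slot
  \<open>i\<close>, which is nonnegative by positivity.\<close>

lemma max_tensor_le_upd_one:
  assumes n: "1 \<le> n" "i < n" and g: "\<And>i. i < n \<Longrightarrow> gA i \<in> AKp KA" "\<And>i. i < n \<Longrightarrow> gB i \<in> AKp KB"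
  shows "(\<And>x. x \<in> KA \<Longrightarrow> gA i x \<le> 1) \<Longrightarrow> Y n gA gB \<le> Y n (gA(i := oneK KA)) gB"
    and "(\<And>x. x \<in> KB \<Longrightarrow> gB i x \<le> 1) \<Longrightarrow> Y n gA gB \<le> Y n gA (gB(i := oneK KB))"
proof -
  note M = max_tensorD[OF bicompatibleD(1)[OF Y n(1)]]
  have v: "valid_args KA KB n gA gB" using g by (auto simp: valid_args_def AKp_def)
  have gi: "gA i \<in> AK KA" "gB i \<in> AK KB" using g[OF n(2)] by (auto simp: AKp_def)
  show "Y n gA gB \<le> Y n (gA(i := oneK KA)) gB" if le: "\<And>x. x \<in> KA \<Longrightarrow> gA i x \<le> 1"
  proof -
    let ?c = "\<lambda>x. oneK KA x + (-1) * gA i x"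
    have "?c \<in> AKp KA"
      by (rule AKp_complement[OF cv(1) gi(1) le])
    then have "0 \<le> Y n (gA(i := ?c)) gB" using g by (intro M(5)) auto
    then show ?thesis using AK_linearD[OF M(3)[OF v n(2)] oneK_in_AK[OF cv(1)] gi(1), of "-1"] by simp
  qed
  show "Y n gA gB \<le> Y n gA (gB(i := oneK KB))" if le: "\<And>x. x \<in> KB \<Longrightarrow> gB i x \<le> 1"
  proof -
    let ?c = "\<lambda>x. oneK KB x + (-1) * gB i x"
    have "?c \<in> AKp KB"
      by (rule AKp_complement[OF cv(2) gi(2) le])
    then have "0 \<le> Y n gA (gB(i := ?c))" using g by (intro M(5)) auto
    then show ?thesis using AK_linearD[OF M(4)[OF v n(2)] oneK_in_AK[OF cv(2)] gi(2), of "-1"] by simp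
  qed
qed

text \<open>The four effects are replaced by units one at a time, each time increasing the value,
  until normalisation gives 1.\<close>

lemma mom_bounds:
  assumes "a \<in> AKp KA" "a' \<in> AKp KA" "b \<in> AKp KB" "b' \<in> AKp KB"
    and "\<And>x. x \<in> KA \<Longrightarrow> a x \<le> 1" "\<And>x. x \<in> KA \<Longrightarrow> a' x \<le> 1"
    and "\<And>x. x \<in> KB \<Longrightarrow> b x \<le> 1" "\<And>x. x \<in> KB \<Longrightarrow> b' x \<le> 1"
  shows "0 \<le> mom Y (a, b) (a', b')" "mom Y (a, b) (a', b') \<le> 1"
proof -
  note M = max_tensorD[OF bicompatibleD(1)[OF Y, of 2]]
  note one = oneK_in_AKp[OF cv(1)] oneK_in_AKp[OF cv(2)]
  show "0 \<le> mom Y (a, b) (a', b')"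
    unfolding mom_def fst_conv snd_conv using assms by (intro M(5)) (auto simp: two_def less_2_cases_iff)
  have "mom Y (a, b) (a', b') \<le> Y 2 ((two a a')(0 := oneK KA)) (two b b')"
    unfolding mom_def fst_conv snd_conv using assms
    by (intro max_tensor_le_upd_one(1)) (auto simp: two_def less_2_cases_iff)
  also have "\<dots> \<le> Y 2 ((two a a')(0 := oneK KA, 1 := oneK KA)) (two b b')"
    using assms one by (intro max_tensor_le_upd_one(1)) (auto simp: two_def less_2_cases_iff)
  also have "\<dots> \<le> Y 2 ((two a a')(0 := oneK KA, 1 := oneK KA)) ((two b b')(0 := oneK KB))"
    using assms one by (intro max_tensor_le_upd_one(2)) (auto simp: two_def less_2_cases_iff)
  also have "\<dots> \<le> Y 2 ((two a a')(0 := oneK KA, 1 := oneK KA)) ((two b b')(0 := oneK KB, 1 := oneK KB))"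
    using assms one by (intro max_tensor_le_upd_one(2)) (auto simp: two_def less_2_cases_iff)
  also have "\<dots> = Y 2 (\<lambda>_. oneK KA) (\<lambda>_. oneK KB)"
    by (intro M(2)) (auto simp: less_2_cases_iff)
  also have "\<dots> = 1" using M(6) by simp
  finally show "mom Y (a, b) (a', b') \<le> 1" .
qed

end

text \<open>The deviation equals \<open>\<alpha> * (1 - \<alpha>) * (t1 - t2)\<close>. Its square is
  the variance times \<open>\<alpha> * (1 - \<alpha>)\<close>, a factor of at most 1.\<close>

lemma convex_part_deviation:
  fixes \<alpha> :: real
  assumes "t = \<alpha> * t1 + (1 - \<alpha>) * t2" "0 \<le> \<alpha>" "\<alpha> \<le> 1" "\<alpha> * (1 - \<alpha>) * (t1 - t2)\<^sup>2 \<le> s\<^sup>2" "0 \<le> s"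
  shows "\<bar>\<alpha> * t1 - \<alpha> * t\<bar> \<le> s"
proof -
  have "\<alpha> * t1 - \<alpha> * t = \<alpha> * (1 - \<alpha>) * (t1 - t2)" unfolding assms(1) by (simp add: algebra_simps)
  then have "(\<alpha> * t1 - \<alpha> * t)\<^sup>2 = (\<alpha> * (1 - \<alpha>)) * (\<alpha> * (1 - \<alpha>) * (t1 - t2)\<^sup>2)"
    by (simp add: power2_eq_square)
  also have "\<dots> \<le> 1 * (\<alpha> * (1 - \<alpha>) * (t1 - t2)\<^sup>2)"
    using assms(2,3) by (intro mult_right_mono mult_le_one mult_nonneg_nonneg) auto
  also have "\<dots> \<le> s\<^sup>2" using assms(4) by simp
  finally show ?thesis using assms(5) by (metis abs_le_square_iff abs_of_nonneg)
qed

text \<open>A quantitative form of extremality: for \<open>s = 0\<close> it says that the table of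
  moments over \<open>M\<close> is extreme among those of bicompatible sequences. Only the moments
  over \<open>M\<close> have to decompose, not the whole sequence.\<close>

definition near_extreme where
  "near_extreme KA KB M s Y \<longleftrightarrow> (\<forall>Y1 Y2 \<alpha>. bicompatible KA KB Y1 \<longrightarrow> bicompatible KA KB Y2 \<longrightarrow>
    0 \<le> \<alpha> \<longrightarrow> \<alpha> \<le> 1 \<longrightarrow>
    (\<forall>p\<in>M. \<forall>q\<in>M. mom Y p q = \<alpha> * mom Y1 p q + (1 - \<alpha>) * mom Y2 p q) \<longrightarrow>
    (\<forall>p\<in>M. \<forall>q\<in>M. \<alpha> * (1 - \<alpha>) * (mom Y1 p q - mom Y2 p q)\<^sup>2 \<le> s\<^sup>2))"

text \<open>The effects \<open>r\<close> and \<open>r'\<close> are complementary outcomes.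
  Conditioning on them decomposes the moments, and near-extremality forces both parts to be close:
  the outcome \<open>r\<close> is almost independent of the other two pairs.\<close>

lemma near_extreme_mom3:
  assumes Y: "bicompatible KA KB Y" and cv: "convex KA" "convex KB"
    and ext: "near_extreme KA KB M s Y"
    and s: "0 \<le> s" and M: "M \<subseteq> AK KA \<times> AK KB"
    and r: "fst r \<in> AKp KA" "snd r \<in> AKp KB" "fst r' \<in> AKp KA" "snd r' \<in> AKp KB"
    and \<alpha>: "Y 1 (\<lambda>_. fst r) (\<lambda>_. snd r) = \<alpha>" "Y 1 (\<lambda>_. fst r') (\<lambda>_. snd r') = 1 - \<alpha>" "0 < \<alpha>" "\<alpha> < 1"
    and split: "\<And>p q. p \<in> M \<Longrightarrow> q \<in> M \<Longrightarrow> mom Y p q = mom3 Y r p q + mom3 Y r' p q"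
    and pq: "p \<in> M" "q \<in> M"
  shows "\<bar>mom3 Y r p q - \<alpha> * mom Y p q\<bar> \<le> s"
proof -
  let ?Y1 = "condition Y (fst r) (snd r)" and ?Y2 = "condition Y (fst r') (snd r')"
  have b: "bicompatible KA KB ?Y1" "bicompatible KA KB ?Y2"
    using r \<alpha> by (auto intro!: bicompatible_condition[OF Y cv])
  \<comment> \<open>A joint moment is the probability of the outcome times the conditional
    moment.\<close>
  have m: "mom3 Y r p q = \<alpha> * mom ?Y1 p q" "mom3 Y r' p q = (1 - \<alpha>) * mom ?Y2 p q" for p q
    using \<alpha> by (auto simp: mom_condition)
  have dec: "mom Y p q = \<alpha> * mom ?Y1 p q + (1 - \<alpha>) * mom ?Y2 p q" if "p \<in> M" "q \<in> M" for p q
    using split[OF that] m by simp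
  have "\<alpha> * (1 - \<alpha>) * (mom ?Y1 p q - mom ?Y2 p q)\<^sup>2 \<le> s\<^sup>2"
    using ext b \<alpha>(3,4) dec pq unfolding near_extreme_def by (meson less_imp_le)
  from convex_part_deviation[OF dec[OF pq] _ _ this s] show ?thesis using \<alpha>(3,4) m by simp
qed

text \<open>Three approximate factorisations are chained. Since \<open>u\<close> and
  \<open>v\<close> are at most 1 in absolute value, no error is amplified.\<close>

lemma abs_telescope_le:
  fixes u :: real
  assumes "\<bar>t0 - u * t1\<bar> \<le> s" "\<bar>t1 - v * t2\<bar> \<le> s" "\<bar>t2 - w\<bar> \<le> s" "\<bar>u\<bar> \<le> 1" "\<bar>v\<bar> \<le> 1"
  shows "\<bar>t0 - u * (v * w)\<bar> \<le> 3 * s"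
proof -
  have "\<bar>v * (t2 - w)\<bar> \<le> s" "\<bar>u * (t1 - v * t2)\<bar> \<le> s"
    using assms mult_mono[of "\<bar>v\<bar>" 1 "\<bar>t2 - w\<bar>" s] mult_mono[of "\<bar>u\<bar>" 1 "\<bar>t1 - v * t2\<bar>" s]
    by (auto simp: abs_mult)
  moreover have "\<bar>u * (v * (t2 - w))\<bar> \<le> 1 * s"
    unfolding abs_mult[of u] using assms(4) calculation(1) by (intro mult_mono) auto
  moreover have "t0 - u * (v * w) = (t0 - u * t1) + u * (t1 - v * t2) + u * (v * (t2 - w))"
    by (simp add: algebra_simps)
  ultimately show ?thesis using assms(1) by linarith
qed

text \<open>Each frame element is observed against its complement, so
  \<open>near_extreme_mom3\<close> splits it off with error \<open>s\<close>. Its probability is its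
  value at the barycentre \<open>x\<close> or \<open>y\<close> of the marginal state, and the frame
  bounds keep that value strictly between 0 and 1.\<close>

lemma near_extreme_factorises:
  fixes KA :: "'a::euclidean_space set" and KB :: "'b::euclidean_space set"
  assumes Y: "bicompatible KA KB Y" and K: "compact KA" "convex KA" "compact KB" "convex KB"
    and E_sub: "E \<subseteq> AK KA" "\<forall>e\<in>E. \<forall>x\<in>KA. 1/4 \<le> e x \<and> e x \<le> 3/4"
    and D_sub: "D \<subseteq> AK KB" "\<forall>d\<in>D. \<forall>y\<in>KB. 1/4 \<le> d y \<and> d y \<le> 3/4"
    and M: "M = insert (oneK KA) E \<times> insert (oneK KB) D"
    and ext: "near_extreme KA KB M s Y"
    and s: "0 \<le> s"
  obtains x y where "x \<in> KA" "y \<in> KB"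
    "\<And>a b a' b'. a \<in> E \<Longrightarrow> b \<in> D \<Longrightarrow> a' \<in> E \<Longrightarrow> b' \<in> D \<Longrightarrow>
      \<bar>mom Y (a, b) (a', b') - a x * (a' x * (b y * b' y))\<bar> \<le> 3 * s"
proof -
  have E: "\<And>e. e \<in> E \<Longrightarrow> e \<in> AK KA" "\<And>e x. e \<in> E \<Longrightarrow> x \<in> KA \<Longrightarrow> 1/4 \<le> e x \<and> e x \<le> 3/4"
    and D: "\<And>d. d \<in> D \<Longrightarrow> d \<in> AK KB" "\<And>d y. d \<in> D \<Longrightarrow> y \<in> KB \<Longrightarrow> 1/4 \<le> d y \<and> d y \<le> 3/4"
    using E_sub D_sub by blast+
  let ?A = "oneK KA" and ?B = "oneK KB"
  note cv = K(2,4)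
  note st = bicompatible_state[OF Y cv]
  note one = oneK_in_AKp[OF cv(1)] oneK_in_AKp[OF cv(2)] oneK_in_AK[OF cv(1)] oneK_in_AK[OF cv(2)]
  obtain x where x: "x \<in> KA" "\<And>g. g \<in> AK KA \<Longrightarrow> Y 1 (\<lambda>_. g) (\<lambda>_. ?B) = g x"
    using AK_state_eq_evaluation[OF K(1,2) st(1)[OF one(4)] st(3)[OF _ one(2)] st(4)] by metis
  obtain y where y: "y \<in> KB" "\<And>g. g \<in> AK KB \<Longrightarrow> Y 1 (\<lambda>_. ?A) (\<lambda>_. g) = g y"
    using AK_state_eq_evaluation[OF K(3,4) st(2)[OF one(3)] st(3)[OF one(1)] st(4)] by metis
  have M_AK: "M \<subseteq> AK KA \<times> AK KB" using E(1) D(1) one by (auto simp: M)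
  have Ep: "a \<in> AKp KA" "(\<lambda>x. ?A x + (-1) * a x) \<in> AKp KA" "0 < a x" "a x < 1" if "a \<in> E" for a
  proof -
    show "a \<in> AKp KA" using E(1)[OF that] E(2)[OF that] by (force simp: AKp_def)
    show "(\<lambda>x. ?A x + (-1) * a x) \<in> AKp KA"
      using E(2)[OF that] by (intro AKp_complement[OF cv(1) E(1)[OF that]]) force
    show "0 < a x" "a x < 1" using E(2)[OF that x(1)] by auto
  qed
  have Dp: "b \<in> AKp KB" "(\<lambda>y. ?B y + (-1) * b y) \<in> AKp KB" "0 < b y" "b y < 1" if "b \<in> D" for b
  proof -
    show "b \<in> AKp KB" using D(1)[OF that] D(2)[OF that] by (force simp: AKp_def)
    show "(\<lambda>y. ?B y + (-1) * b y) \<in> AKp KB"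
      using D(2)[OF that] by (intro AKp_complement[OF cv(2) D(1)[OF that]]) force
    show "0 < b y" "b y < 1" using D(2)[OF that y(1)] by auto
  qed
  \<comment> \<open>The unit on the B-side of the observed pair makes this a measurement of the
    A-part alone; \<open>condB\<close> is its mirror image.\<close>
  have condA: "\<bar>mom3 Y (a, ?B) p q - a x * mom Y p q\<bar> \<le> s" if a: "a \<in> E" and pq: "p \<in> M" "q \<in> M" for a p q
  proof (rule near_extreme_mom3[OF Y cv ext s M_AK])
    let ?c = "\<lambda>x. ?A x + (-1) * a x"
    have c: "?c \<in> AK KA" using Ep(2)[OF a] by (auto simp: AKp_def)
    show "Y 1 (\<lambda>_. fst (a, ?B)) (\<lambda>_. snd (a, ?B)) = a x" using x(2)[OF E(1)[OF a]] by simp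
    show "Y 1 (\<lambda>_. fst (?c, ?B)) (\<lambda>_. snd (?c, ?B)) = 1 - a x" using x(2)[OF c] x(1) by (simp add: oneK_def)
    fix p q assume "p \<in> M" "q \<in> M"
    then have m: "p \<in> AK KA \<times> AK KB" "q \<in> AK KA \<times> AK KB" using M_AK by auto
    show "mom Y p q = mom3 Y (a, ?B) p q + mom3 Y (?c, ?B) p q"
      using mom_eq_mom3[OF Y cv m] AK_linearD[OF mom3_linear(1)[OF Y cv m one(4)] one(3) E(1)[OF a], of "-1"]
      by simp
  qed (use Ep[OF a] one pq in auto)
  have condB: "\<bar>mom3 Y (?A, b) p q - b y * mom Y p q\<bar> \<le> s" if b: "b \<in> D" and pq: "p \<in> M" "q \<in> M" for b p q
  proof (rule near_extreme_mom3[OF Y cv ext s M_AK])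
    let ?c = "\<lambda>y. ?B y + (-1) * b y"
    have c: "?c \<in> AK KB" using Dp(2)[OF b] by (auto simp: AKp_def)
    show "Y 1 (\<lambda>_. fst (?A, b)) (\<lambda>_. snd (?A, b)) = b y" using y(2)[OF D(1)[OF b]] by simp
    show "Y 1 (\<lambda>_. fst (?A, ?c)) (\<lambda>_. snd (?A, ?c)) = 1 - b y" using y(2)[OF c] y(1) by (simp add: oneK_def)
    fix p q assume "p \<in> M" "q \<in> M"
    then have m: "p \<in> AK KA \<times> AK KB" "q \<in> AK KA \<times> AK KB" using M_AK by auto
    show "mom Y p q = mom3 Y (?A, b) p q + mom3 Y (?A, ?c) p q"
      using mom_eq_mom3[OF Y cv m] AK_linearD[OF mom3_linear(2)[OF Y cv m one(3)] one(4) D(1)[OF b], of "-1"]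
      by simp
  qed (use Dp[OF b] one pq in auto)
  \<comment> \<open>The factors \<open>a\<close>, \<open>a'\<close> and \<open>b\<close> are split
    off in turn, each leaving a unit behind. What then remains is the marginal value
    \<open>b' y\<close>, exactly, so four factors cost only three errors.\<close>
  have "\<bar>mom Y (a, b) (a', b') - a x * (a' x * (b y * b' y))\<bar> \<le> 3 * s"
    if ab: "a \<in> E" "b \<in> D" "a' \<in> E" "b' \<in> D" for a b a' b'
  proof (rule abs_telescope_le)
    note AK = E(1)[OF ab(1)] E(1)[OF ab(3)] D(1)[OF ab(2)] D(1)[OF ab(4)] one(3,4)
    have "mom Y (a, b) (a', b') = mom3 Y (a, ?B) (?A, b) (a', b')"
      using AK mom3_swap(1)[OF Y cv] by (subst mom_eq_mom3[OF Y cv]) auto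
    then show "\<bar>mom Y (a, b) (a', b') - a x * mom Y (?A, b) (a', b')\<bar> \<le> s"
      using condA[OF ab(1), of "(?A, b)" "(a', b')"] ab by (simp add: M)
    have "mom Y (?A, b) (a', b') = mom3 Y (a', ?B) (?A, b) (?A, b')"
      using AK mom3_swap(2)[OF Y cv] by (subst mom_eq_mom3[OF Y cv]) auto
    then show "\<bar>mom Y (?A, b) (a', b') - a' x * mom Y (?A, b) (?A, b')\<bar> \<le> s"
      using condA[OF ab(3), of "(?A, b)" "(?A, b')"] ab by (simp add: M)
    have "mom Y (?A, b) (?A, b') = mom3 Y (?A, b) (?A, ?B) (?A, b')"
      using AK mom3_swap(3)[OF Y cv] by (subst mom_eq_mom3[OF Y cv]) auto
    then show "\<bar>mom Y (?A, b) (?A, b') - b y * b' y\<bar> \<le> s"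
      using condB[OF ab(2), of "(?A, ?B)" "(?A, b')"] ab mom_marginal[OF Y cv AK(4)] y(2)[OF AK(4)]
      by (simp add: M)
  qed (use Ep(3,4)[OF ab(1)] Ep(3,4)[OF ab(3)] in auto)
  then show ?thesis by (rule that[OF x(1) y(1)])
qed

text \<open>Half of \<open>\<epsilon>\<close> pays for passing from \<open>Y0\<close> to a nearly
  extreme near-minimiser \<open>Y\<close> of the functional \<open>c\<close>, the other half for
  replacing the moments of \<open>Y\<close> by those of a product state.\<close>

lemma product_state_le_bicompatible:
  fixes KA :: "'a::euclidean_space set" and KB :: "'b::euclidean_space set"
    and c :: "('a \<Rightarrow> real) \<times> ('b \<Rightarrow> real) \<Rightarrow> ('a \<Rightarrow> real) \<times> ('b \<Rightarrow> real) \<Rightarrow> real"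
  assumes Y0: "bicompatible KA KB Y0" and K: "compact KA" "convex KA" "compact KB" "convex KB"
    and E: "finite E" "E \<subseteq> AK KA" "\<forall>e\<in>E. \<forall>x\<in>KA. 1/4 \<le> e x \<and> e x \<le> 3/4"
    and D: "finite D" "D \<subseteq> AK KB" "\<forall>d\<in>D. \<forall>y\<in>KB. 1/4 \<le> d y \<and> d y \<le> 3/4"
    and \<epsilon>: "\<epsilon> > 0"
  obtains x y where "x \<in> KA" "y \<in> KB"
    "(\<Sum>p\<in>E \<times> D. \<Sum>q\<in>E \<times> D. c p q * ((fst p x * snd p y) * (fst q x * snd q y)))
      \<le> (\<Sum>p\<in>E \<times> D. \<Sum>q\<in>E \<times> D. c p q * mom Y0 p q) + \<epsilon>"
proof -
  note cv = K(2,4)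
  \<comment> \<open>The units belong to the test set because splitting off a factor leaves a unit in
    its slot.\<close>
  define M where "M = insert (oneK KA) E \<times> insert (oneK KB) D"
  define N where "N = E \<times> D"
  have fin: "finite (M \<times> M)" "finite N" using E(1) D(1) by (auto simp: M_def N_def)
  have NM: "N \<times> N \<subseteq> M \<times> M" by (auto simp: M_def N_def)
  define C where "C = (\<Sum>m\<in>N \<times> N. \<bar>c (fst m) (snd m)\<bar>)"
  have C0: "C \<ge> 0" by (simp add: C_def sum_nonneg)
  \<comment> \<open>Chosen so that the factorisation error \<open>3 * s\<close>, weighted by the
    coefficients, is at most \<open>\<epsilon> / 2\<close>; the summand 1 covers the case
    \<open>C = 0\<close>.\<close>
  define s where "s = \<epsilon> / (6 * (C + 1))"
  have s: "s > 0" using \<epsilon> C0 by (simp add: s_def)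
  have sC: "3 * s * C \<le> \<epsilon> / 2"
  proof -
    have "3 * s * C \<le> 3 * s * (C + 1)" using s by simp
    also have "\<dots> = \<epsilon> / 2" using C0 by (simp add: s_def field_simps)
    finally show ?thesis .
  qed
  define T where "T = (\<lambda>(Y :: nat \<Rightarrow> ('a, 'b) tens) m. mom Y (fst m) (snd m))"
  define S where "S = {T Y |Y. bicompatible KA KB Y}"
  \<comment> \<open>The objective sees only the frame moments, whereas near-extremality must also
    control those with units; hence the extension by 0.\<close>
  define c' where "c' = (\<lambda>m. if m \<in> N \<times> N then c (fst m) (snd m) else 0)"
  have sum_c': "(\<Sum>m\<in>M \<times> M. c' m * t m) = (\<Sum>m\<in>N \<times> N. c (fst m) (snd m) * t m)" for t
    using fin(1) NM by (intro sum.mono_neutral_cong_right) (auto simp: c'_def)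
  have sum_N: "(\<Sum>p\<in>N. \<Sum>q\<in>N. g p q) = (\<Sum>m\<in>N \<times> N. g (fst m) (snd m))"
    for g :: "('a \<Rightarrow> real) \<times> ('b \<Rightarrow> real) \<Rightarrow> ('a \<Rightarrow> real) \<times> ('b \<Rightarrow> real) \<Rightarrow> real"
    by (simp add: sum.cartesian_product case_prod_unfold)
  have eff: "a \<in> AKp KA \<and> (\<forall>x\<in>KA. a x \<le> 1)" if "a \<in> insert (oneK KA) E" for a
    using that E(2,3) oneK_in_AKp[OF cv(1)] by (force simp: AKp_def oneK_def)
  have eff': "b \<in> AKp KB \<and> (\<forall>y\<in>KB. b y \<le> 1)" if "b \<in> insert (oneK KB) D" for b
    using that D(2,3) oneK_in_AKp[OF cv(2)] by (force simp: AKp_def oneK_def)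
  have "\<bar>t m\<bar> \<le> 1" if "t \<in> S" "m \<in> M \<times> M" for t m
  proof -
    obtain Y where Y: "bicompatible KA KB Y" "t = T Y" using \<open>t \<in> S\<close> by (auto simp: S_def)
    obtain a b a' b' where m: "m = ((a, b), (a', b'))" by (metis surj_pair)
    have "a \<in> insert (oneK KA) E" "a' \<in> insert (oneK KA) E" "b \<in> insert (oneK KB) D" "b' \<in> insert (oneK KB) D"
      using \<open>m \<in> M \<times> M\<close> by (auto simp: m M_def)
    then show ?thesis
      using mom_bounds[OF Y(1) cv, of a a' b b'] eff[of a] eff[of a'] eff'[of b] eff'[of b'] by (auto simp: Y(2) T_def m)
  qed
  then have bound: "\<forall>t\<in>S. \<forall>m\<in>M \<times> M. \<bar>t m\<bar> \<le> 1" by blast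
  have pos: "T Y0 \<in> S" "\<epsilon> / 2 > 0" "s\<^sup>2 > 0" using Y0 \<epsilon> s by (auto simp: S_def)
  obtain t where t: "t \<in> S" "(\<Sum>m\<in>M \<times> M. c' m * t m) \<le> (\<Sum>m\<in>M \<times> M. c' m * T Y0 m) + \<epsilon> / 2"
    and ext: "\<forall>T1\<in>S. \<forall>T2\<in>S. \<forall>\<alpha>. 0 \<le> \<alpha> \<longrightarrow> \<alpha> \<le> 1 \<longrightarrow>
       (\<forall>m\<in>M \<times> M. t m = \<alpha> * T1 m + (1 - \<alpha>) * T2 m) \<longrightarrow>
       (\<forall>m\<in>M \<times> M. \<alpha> * (1 - \<alpha>) * (T1 m - T2 m)\<^sup>2 \<le> s\<^sup>2)"
    by (rule near_extreme_point[where S = S and M = "M \<times> M" and c = c', OF fin(1) pos(1) bound pos(2,3)])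
  obtain Y where Y: "bicompatible KA KB Y" and tY: "t = T Y" using t(1) by (auto simp: S_def)
  have "near_extreme KA KB M s Y"
    unfolding near_extreme_def
  proof (intro allI impI ballI)
    fix Y1 Y2 \<alpha> p q
    assume h: "bicompatible KA KB Y1" "bicompatible KA KB Y2" "0 \<le> \<alpha>" "\<alpha> \<le> 1"
      "\<forall>p\<in>M. \<forall>q\<in>M. mom Y p q = \<alpha> * mom Y1 p q + (1 - \<alpha>) * mom Y2 p q" "p \<in> M" "q \<in> M"
    have "T Y1 \<in> S" "T Y2 \<in> S" using h(1,2) by (auto simp: S_def)
    moreover have "\<forall>m\<in>M \<times> M. t m = \<alpha> * T Y1 m + (1 - \<alpha>) * T Y2 m" using h(5) by (auto simp: tY T_def)
    ultimately have "\<forall>m\<in>M \<times> M. \<alpha> * (1 - \<alpha>) * (T Y1 m - T Y2 m)\<^sup>2 \<le> s\<^sup>2" using ext h(3,4) by blast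
    then show "\<alpha> * (1 - \<alpha>) * (mom Y1 p q - mom Y2 p q)\<^sup>2 \<le> s\<^sup>2" using h(6,7) by (auto simp: T_def)
  qed
  note fac = near_extreme_factorises[OF Y K E(2,3) D(2,3) M_def this less_imp_le[OF s]]
  obtain x y where xy: "x \<in> KA" "y \<in> KB"
    and approx: "\<And>a b a' b'. a \<in> E \<Longrightarrow> b \<in> D \<Longrightarrow> a' \<in> E \<Longrightarrow> b' \<in> D \<Longrightarrow>
      \<bar>mom Y (a, b) (a', b') - a x * (a' x * (b y * b' y))\<bar> \<le> 3 * s"
    using fac by metis
  define W where "W = (\<lambda>m. (fst (fst m) x * snd (fst m) y) * (fst (snd m) x * snd (snd m) y) :: real)"
  have "c (fst m) (snd m) * W m \<le> c (fst m) (snd m) * T Y m + 3 * s * \<bar>c (fst m) (snd m)\<bar>" if "m \<in> N \<times> N" for m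
  proof -
    obtain a b a' b' where m: "m = ((a, b), (a', b'))" by (metis surj_pair)
    have "\<bar>T Y m - W m\<bar> \<le> 3 * s"
      using approx[of a b a' b'] that by (auto simp: m N_def T_def W_def mult_ac)
    then have "\<bar>c (fst m) (snd m)\<bar> * \<bar>T Y m - W m\<bar> \<le> \<bar>c (fst m) (snd m)\<bar> * (3 * s)"
      by (intro mult_left_mono) auto
    then show ?thesis unfolding abs_mult[symmetric] by (simp add: algebra_simps abs_le_iff)
  qed
  then have "(\<Sum>m\<in>N \<times> N. c (fst m) (snd m) * W m)
      \<le> (\<Sum>m\<in>N \<times> N. c (fst m) (snd m) * T Y m + 3 * s * \<bar>c (fst m) (snd m)\<bar>)"
    by (rule sum_mono)
  also have "\<dots> = (\<Sum>m\<in>N \<times> N. c (fst m) (snd m) * T Y m) + 3 * s * C"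
    by (simp add: sum.distrib C_def sum_distrib_left)
  also have "\<dots> \<le> (\<Sum>m\<in>N \<times> N. c (fst m) (snd m) * T Y0 m) + \<epsilon>"
    using t(2) sC by (simp add: sum_c' tY)
  finally show ?thesis
    by (intro that[OF xy]) (simp add: sum_N W_def T_def flip: N_def)
qed

section \<open>Linear maps on bilinear forms\<close>

lemma zero_in_bilin_forms: "(\<lambda>g h. 0) \<in> bilin_forms KA KB"
  by (simp add: bilin_forms_def)

lemma bilin_forms_lincomb:
  assumes "\<phi> \<in> bilin_forms KA KB" "\<psi> \<in> bilin_forms KA KB"
  shows "(\<lambda>g h. \<phi> g h + c * \<psi> g h) \<in> bilin_forms KA KB"
  using assms by (simp add: bilin_forms_def algebra_simps)

lemma bilin_forms_sum:
  assumes "finite I" "\<And>i. i \<in> I \<Longrightarrow> \<phi> i \<in> bilin_forms KA KB"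
  shows "(\<lambda>g h. \<Sum>i\<in>I. c i * \<phi> i g h) \<in> bilin_forms KA KB"
  using assms
proof (induction I rule: finite_induct)
  case empty
  then show ?case by (simp add: zero_in_bilin_forms)
next
  case (insert i I)
  then have "(\<lambda>g h. (\<Sum>i\<in>I. c i * \<phi> i g h) + c i * \<phi> i g h) \<in> bilin_forms KA KB"
    by (intro bilin_forms_lincomb) auto
  then show ?case using insert by (simp add: add.commute)
qed

lemma linear_on_formsD:
  assumes "linear_on_forms KA KB F" "\<phi> \<in> bilin_forms KA KB" "\<psi> \<in> bilin_forms KA KB"
  shows "F (\<lambda>g h. \<phi> g h + c * \<psi> g h) = F \<phi> + c *\<^sub>R F \<psi>"
  using assms unfolding linear_on_forms_def by simp

lemma linear_on_forms_zero:
  assumes "linear_on_forms KA KB F"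
  shows "F (\<lambda>g h. 0) = 0"
  using linear_on_formsD[OF assms zero_in_bilin_forms zero_in_bilin_forms, of 1] by simp

lemma linear_on_forms_sum:
  assumes F: "linear_on_forms KA KB F" and "finite I" "\<And>i. i \<in> I \<Longrightarrow> \<phi> i \<in> bilin_forms KA KB"
  shows "F (\<lambda>g h. \<Sum>i\<in>I. c i * \<phi> i g h) = (\<Sum>i\<in>I. c i *\<^sub>R F (\<phi> i))"
  using assms(2,3)
proof (induction I rule: finite_induct)
  case empty
  then show ?case using linear_on_forms_zero[OF F] by simp
next
  case (insert i I)
  then have "(\<lambda>g h. \<Sum>i\<in>I. c i * \<phi> i g h) \<in> bilin_forms KA KB" by (intro bilin_forms_sum) auto
  then have "F (\<lambda>g h. (\<Sum>i\<in>I. c i * \<phi> i g h) + c i * \<phi> i g h)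
      = F (\<lambda>g h. \<Sum>i\<in>I. c i * \<phi> i g h) + c i *\<^sub>R F (\<phi> i)"
    using insert.prems by (intro linear_on_formsD[OF F]) auto
  then show ?case using insert by (simp add: add.commute)
qed

lemma bilin_forms_linear:
  assumes "\<phi> \<in> bilin_forms KA KB"
  shows "h \<in> AK KB \<Longrightarrow> AK_linear KA (\<lambda>g. \<phi> g h)" and "g \<in> AK KA \<Longrightarrow> AK_linear KB (\<phi> g)"
    and "\<not> (g \<in> AK KA \<and> h \<in> AK KB) \<Longrightarrow> \<phi> g h = 0"
  using assms unfolding bilin_forms_def AK_linear_def mem_Collect_eq by (elim conjE, simp)+

lemma bilin_formsI:
  assumes "\<And>h. h \<in> AK KB \<Longrightarrow> AK_linear KA (\<lambda>g. \<phi> g h)" "\<And>g. g \<in> AK KA \<Longrightarrow> AK_linear KB (\<phi> g)"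
    and "\<And>g h. \<not> (g \<in> AK KA \<and> h \<in> AK KB) \<Longrightarrow> \<phi> g h = 0"
  shows "\<phi> \<in> bilin_forms KA KB"
  using assms unfolding bilin_forms_def AK_linear_def mem_Collect_eq by (intro conjI) simp_all

lemma ev_tensor_in_bilin_forms: "ev_tensor KA KB x y \<in> bilin_forms KA KB"
  by (rule bilin_formsI) (auto simp: ev_tensor_def AK_linear_def AK_lincomb algebra_simps)

text \<open>A bilinear form is determined by its values on the frames, so \<open>F\<close> becomes a
  finite sum with vector coefficients. This makes the squared norm of \<open>f\<close> a finite
  quadratic expression.\<close>

lemma linear_on_forms_expand:
  assumes F: "linear_on_forms KA KB F"
    and E: "finite E" "E \<subseteq> AK KA" "\<forall>e. AK_linear KA (\<gamma> e)"
      "\<forall>g\<in>AK KA. g = (\<lambda>x. \<Sum>e\<in>E. \<gamma> e g * e x)"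
    and D: "finite D" "D \<subseteq> AK KB" "\<forall>d. AK_linear KB (\<delta> d)"
      "\<forall>h\<in>AK KB. h = (\<lambda>y. \<Sum>d\<in>D. \<delta> d h * d y)"
  obtains v where "\<forall>\<phi>\<in>bilin_forms KA KB. F \<phi> = (\<Sum>p\<in>E \<times> D. \<phi> (fst p) (snd p) *\<^sub>R v p)"
proof -
  \<comment> \<open>The tensor products of the coefficient functionals; their images under
    \<open>F\<close> are the coefficients \<open>v p\<close>. The cut-off to 0 is the normalisation
    of \<open>bilin_forms\<close>.\<close>
  define \<psi> where "\<psi> = (\<lambda>p g h. if g \<in> AK KA \<and> h \<in> AK KB then \<gamma> (fst p) g * \<delta> (snd p) h else 0)"
  have \<psi>: "\<psi> p \<in> bilin_forms KA KB" for p
    using AK_linearD[OF E(3)[rule_format]] AK_linearD[OF D(3)[rule_format]]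
    by (intro bilin_formsI) (auto simp: \<psi>_def AK_linear_def AK_lincomb algebra_simps)
  have "F \<phi> = (\<Sum>p\<in>E \<times> D. \<phi> (fst p) (snd p) *\<^sub>R F (\<psi> p))" if \<phi>: "\<phi> \<in> bilin_forms KA KB" for \<phi>
  proof -
    note lin = bilin_forms_linear[OF \<phi>]
    have "\<phi> g h = (\<Sum>p\<in>E \<times> D. \<phi> (fst p) (snd p) * \<psi> p g h)" for g h
    proof (cases "g \<in> AK KA \<and> h \<in> AK KB")
      case True
      then have g: "g \<in> AK KA" and h: "h \<in> AK KB" by auto
      have "\<phi> g h = (\<Sum>e\<in>E. \<gamma> e g * \<phi> e h)"
        by (subst E(4)[rule_format, OF g]) (rule AK_linear_sum[OF lin(1)[OF h] E(1) subsetD[OF E(2)]])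
      also have "\<dots> = (\<Sum>e\<in>E. \<gamma> e g * (\<Sum>d\<in>D. \<delta> d h * \<phi> e d))"
      proof (rule sum.cong[OF refl])
        fix e assume "e \<in> E"
        have "\<phi> e h = (\<Sum>d\<in>D. \<delta> d h * \<phi> e d)"
          by (subst D(4)[rule_format, OF h]) (rule AK_linear_sum[OF lin(2)[OF subsetD[OF E(2) \<open>e \<in> E\<close>]] D(1) subsetD[OF D(2)]])
        then show "\<gamma> e g * \<phi> e h = \<gamma> e g * (\<Sum>d\<in>D. \<delta> d h * \<phi> e d)" by simp
      qed
      also have "\<dots> = (\<Sum>p\<in>E \<times> D. \<phi> (fst p) (snd p) * \<psi> p g h)"
        using True by (simp add: \<psi>_def sum_distrib_left sum.cartesian_product case_prod_unfold mult_ac)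
      finally show ?thesis .
    next
      case False
      then show ?thesis
        using lin(3)[OF False] by (simp only: \<psi>_def False if_False mult_zero_right sum.neutral_const)
    qed
    then have "\<phi> = (\<lambda>g h. \<Sum>p\<in>E \<times> D. \<phi> (fst p) (snd p) * \<psi> p g h)"
      unfolding fun_eq_iff by (intro allI)
    then have "F \<phi> = F (\<lambda>g h. \<Sum>p\<in>E \<times> D. \<phi> (fst p) (snd p) * \<psi> p g h)" by (rule arg_cong)
    also have "\<dots> = (\<Sum>p\<in>E \<times> D. \<phi> (fst p) (snd p) *\<^sub>R F (\<psi> p))"
      using E(1) D(1) \<psi> by (intro linear_on_forms_sum[OF F]) auto
    finally show ?thesis .
  qed
  then show ?thesis by (intro that ballI)
qed

text \<open>Fixing the second pair leaves a form in the first, to which \<open>F\<close> can be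
  applied.\<close>

lemma mom_in_bilin_forms:
  assumes Y: "bicompatible KA KB Y" and q: "q \<in> AK KA \<times> AK KB"
  shows "(\<lambda>g h. mom Y (g, h) q) \<in> bilin_forms KA KB"
proof (rule bilin_formsI)
  note M = max_tensorD[OF bicompatibleD(1)[OF Y, of 2]]
  have v: "valid_args KA KB 2 (two g (fst q)) (two h (snd q)) \<longleftrightarrow> g \<in> AK KA \<and> h \<in> AK KB" for g h
    using q by (auto simp: valid_args_two)
  \<comment> \<open>The entry \<open>fst q\<close> in slot 0 is a valid placeholder that the update
    overwrites.\<close>
  show "AK_linear KA (\<lambda>g. mom Y (g, h) q)" if "h \<in> AK KB" for h
    using M(3)[of "two (fst q) (fst q)" "two h (snd q)" 0] v[of "fst q" h] that q
    by (simp add: mom_def two_upd_0 mem_Times_iff)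
  show "AK_linear KB (\<lambda>h. mom Y (g, h) q)" if "g \<in> AK KA" for g
    using M(4)[of "two g (fst q)" "two (snd q) (snd q)" 0] v[of g "snd q"] that q
    by (simp add: mom_def two_upd_0 mem_Times_iff)
  show "mom Y (g, h) q = 0" if "\<not> (g \<in> AK KA \<and> h \<in> AK KB)" for g h
    using M(1) v that by (simp add: mom_def)
qed

text \<open>The units in the slots from 2 on are discarded one pair at a time, which reduces any
  level to level 2.\<close>

lemma bicompatible_marginal_two:
  assumes Y: "bicompatible KA KB Y" and cv: "convex KA" "convex KB" and n: "n \<ge> 2"
    and v: "a \<in> AK KA" "a' \<in> AK KA" "b \<in> AK KB" "b' \<in> AK KB"
  shows "Y n ((\<lambda>_. oneK KA)(0 := a, 1 := a')) ((\<lambda>_. oneK KB)(0 := b, 1 := b')) = mom Y (a, b) (a', b')"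
  using n
proof (induction n rule: dec_induct)
  case base
  show ?case unfolding mom_def fst_conv snd_conv
    by (rule max_tensorD(2)[OF bicompatibleD(1)[OF Y, of 2]]) (auto simp: two_def less_2_cases_iff)
next
  case (step n)
  let ?A = "(\<lambda>_. oneK KA)(0 := a, 1 := a')" and ?B = "(\<lambda>_. oneK KB)(0 := b, 1 := b')"
  have "valid_args KA KB (Suc n - 1) ?A ?B"
    using v cv by (auto simp: valid_args_def oneK_in_AK)
  from bicompatibleD(2)[OF Y _ this] step.hyps
  have "Y (Suc n) (?A(n := oneK KA)) (?B(n := oneK KB)) = Y n ?A ?B" by simp
  moreover have "?A(n := oneK KA) = ?A" "?B(n := oneK KB) = ?B"
    using step.hyps by (auto simp: fun_eq_iff)
  ultimately have "Y (Suc n) ?A ?B = Y n ?A ?B" by (simp only:)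
  then show ?case using step.IH by (rule trans)
qed

text \<open>The equation is evaluated at \<open>q\<close> in slot 1 and units in all later slots.
  The bound \<open>n \<ge> 2\<close> provides slot 1.\<close>

lemma f_tensor_id_zero_imp:
  assumes Y: "bicompatible KA KB Y" and cv: "convex KA" "convex KB" and F: "linear_on_forms KA KB F"
    and n: "n \<ge> 2" and zero: "f_tensor_id F (reorder_S (Y n)) = (\<lambda>_. 0)" and q: "q \<in> AK KA \<times> AK KB"
  shows "F (\<lambda>g h. mom Y (g, h) q) = 0"
proof -
  define p where "p = (\<lambda>_::nat. (oneK KA, oneK KB))(1 := q)"
  have fst_p: "fst \<circ> p(0 := (g, h)) = (\<lambda>_. oneK KA)(0 := g, 1 := fst q)"
    and snd_p: "snd \<circ> p(0 := (g, h)) = (\<lambda>_. oneK KB)(0 := h, 1 := snd q)" for g h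
    by (auto simp: p_def fun_eq_iff)
  note M = max_tensorD[OF bicompatibleD(1)[OF Y]]
  \<comment> \<open>\<open>F\<close> acts on this function of \<open>g\<close> and \<open>h\<close>
    as a whole, so the equality is also needed at invalid arguments, where both sides have the
    default value 0.\<close>
  have "reorder_S (Y n) (p(0 := (g, h))) = mom Y (g, h) q" for g h
  proof (cases "g \<in> AK KA \<and> h \<in> AK KB")
    case True
    then show ?thesis
      using bicompatible_marginal_two[OF Y cv n, of g "fst q" h "snd q"] q
      unfolding reorder_S_def fst_p snd_p by auto
  next
    case False
    then have "\<not> valid_args KA KB n ((\<lambda>_. oneK KA)(0 := g, 1 := fst q)) ((\<lambda>_. oneK KB)(0 := h, 1 := snd q))"
      using n by (auto simp: valid_args_def intro!: exI[of _ 0])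
    then have "reorder_S (Y n) (p(0 := (g, h))) = 0"
      unfolding reorder_S_def fst_p snd_p using n by (intro M(1)) auto
    then show ?thesis using bilin_forms_linear(3)[OF mom_in_bilin_forms[OF Y q] False] by simp
  qed
  then show ?thesis using fun_cong[OF zero, of p] by (simp add: f_tensor_id_def)
qed

section \<open>Product sequences\<close>

definition product_seq :: "'a::real_vector set \<Rightarrow> 'b::real_vector set \<Rightarrow> 'a \<Rightarrow> 'b \<Rightarrow> nat \<Rightarrow> ('a, 'b) tens" where
  "product_seq KA KB x y n = (\<lambda>gA gB. if valid_args KA KB n gA gB then \<Prod>i<n. gA i x * gB i y else 0)"

text \<open>Isolates the factor of slot \<open>i\<close>, which makes linearity in that slot
  visible; the weights \<open>w\<close> stand for the other side of the tensor product.\<close>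

lemma prod_fun_upd_linear:
  fixes n :: nat and g :: "nat \<Rightarrow> 'a \<Rightarrow> real"
  assumes "i < n"
  shows "(\<Prod>j<n. (g(i := a)) j x * w j) = a x * w i * (\<Prod>j\<in>{..<n} - {i}. g j x * w j)"
proof -
  have "(\<Prod>j<n. (g(i := a)) j x * w j) = a x * w i * (\<Prod>j\<in>{..<n} - {i}. (g(i := a)) j x * w j)"
    using assms by (subst prod.remove[of _ i]) auto
  also have "(\<Prod>j\<in>{..<n} - {i}. (g(i := a)) j x * w j) = (\<Prod>j\<in>{..<n} - {i}. g j x * w j)"
    by (intro prod.cong) auto
  finally show ?thesis .
qed

lemma valid_args_upd:
  "i < n \<Longrightarrow> valid_args KA KB n gA gB \<Longrightarrow> a \<in> AK KA \<Longrightarrow> valid_args KA KB n (gA(i := a)) gB"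
  "i < n \<Longrightarrow> valid_args KA KB n gA gB \<Longrightarrow> b \<in> AK KB \<Longrightarrow> valid_args KA KB n gA (gB(i := b))"
  by (auto simp: valid_args_def)

lemma bicompatible_product_seq:
  assumes xy: "x \<in> KA" "y \<in> KB" and cv: "convex KA" "convex KB"
  shows "bicompatible KA KB (product_seq KA KB x y)"
proof -
  let ?P = "product_seq KA KB x y"
  have one: "oneK KA x = 1" "oneK KB y = 1" using xy by (auto simp: oneK_def)
  have "?P n \<in> max_tensor KA KB n" for n
  proof -
    have "?P n \<in> tensor_space KA KB n"
      unfolding tensor_space_def mem_Collect_eq
    proof (intro conjI allI impI ballI)
      fix gA gB assume "\<not> valid_args KA KB n gA gB"
      then show "?P n gA gB = 0" by (simp add: product_seq_def)
    next
      fix gA gA' :: "nat \<Rightarrow> 'a \<Rightarrow> real" and gB gB' :: "nat \<Rightarrow> 'b \<Rightarrow> real"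
      assume "\<forall>i<n. gA i = gA' i \<and> gB i = gB' i"
      then have "valid_args KA KB n gA gB = valid_args KA KB n gA' gB'"
        and "(\<Prod>i<n. gA i x * gB i y) = (\<Prod>i<n. gA' i x * gB' i y)"
        by (auto simp: valid_args_def intro!: prod.cong)
      then show "?P n gA gB = ?P n gA' gB'" by (simp add: product_seq_def)
    next
      fix gA gB i g g' and r :: real
      assume v: "valid_args KA KB n gA gB" "i < n" "g \<in> AK KA" "g' \<in> AK KA"
      then show "?P n (gA(i := \<lambda>x. g x + r * g' x)) gB = ?P n (gA(i := g)) gB + r * ?P n (gA(i := g')) gB"
        using prod_fun_upd_linear[of i n gA _ x "\<lambda>j. gB j y"]
        by (simp add: product_seq_def valid_args_upd AK_lincomb algebra_simps del: fun_upd_apply)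
    next
      fix gA gB i g g' and r :: real
      assume v: "valid_args KA KB n gA gB" "i < n" "g \<in> AK KB" "g' \<in> AK KB"
      then show "?P n gA (gB(i := \<lambda>x. g x + r * g' x)) = ?P n gA (gB(i := g)) + r * ?P n gA (gB(i := g'))"
        using prod_fun_upd_linear[of i n gB _ y "\<lambda>j. gA j x"]
        by (simp add: product_seq_def valid_args_upd AK_lincomb mult.commute[of "gA _ x"] del: fun_upd_apply)
          (simp add: algebra_simps)
    qed
    moreover have "0 \<le> ?P n gA gB" if "\<forall>i<n. gA i \<in> AKp KA \<and> gB i \<in> AKp KB" for gA gB
      using that xy by (auto simp: product_seq_def AKp_def intro!: prod_nonneg mult_nonneg_nonneg)
    moreover have "?P n (\<lambda>_. oneK KA) (\<lambda>_. oneK KB) = 1"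
      using cv by (simp add: product_seq_def one valid_args_def oneK_in_AK)
    ultimately show ?thesis unfolding max_tensor_def by blast
  qed
  moreover have "?P (n - 1) gA gB = ?P n (gA(n - 1 := oneK KA)) (gB(n - 1 := oneK KB))"
    if n: "n \<ge> 2" and v: "valid_args KA KB (n - 1) gA gB" for n gA gB
  proof -
    obtain k where k: "n = Suc k" using n by (cases n) auto
    show ?thesis using v by (simp add: product_seq_def k valid_args_Suc_upd oneK_in_AK cv one)
  qed
  moreover have "?P n (gA \<circ> \<sigma>A) (gB \<circ> \<sigma>B) = ?P n gA gB"
    if \<sigma>: "\<sigma>A permutes {..<n}" "\<sigma>B permutes {..<n}" for n \<sigma>A \<sigma>B gA gB
  proof -
    have im: "\<sigma>A ` {..<n} = {..<n}" "\<sigma>B ` {..<n} = {..<n}" using \<sigma> by (auto simp: permutes_image)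
    have "(\<forall>i<n. gA (\<sigma>A i) \<in> AK KA) \<longleftrightarrow> (\<forall>i\<in>\<sigma>A ` {..<n}. gA i \<in> AK KA)"
      "(\<forall>i<n. gB (\<sigma>B i) \<in> AK KB) \<longleftrightarrow> (\<forall>i\<in>\<sigma>B ` {..<n}. gB i \<in> AK KB)" by auto
    then have "valid_args KA KB n (gA \<circ> \<sigma>A) (gB \<circ> \<sigma>B) \<longleftrightarrow> valid_args KA KB n gA gB"
      unfolding im by (auto simp: valid_args_def)
    \<comment> \<open>The A-factors and the B-factors are reindexed separately, as the two
      permutations are unrelated.\<close>
    moreover have "(\<Prod>i<n. gA (\<sigma>A i) x) = (\<Prod>i<n. gA i x)" "(\<Prod>i<n. gB (\<sigma>B i) y) = (\<Prod>i<n. gB i y)"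
      using prod.permute[OF \<sigma>(1), of "\<lambda>i. gA i x"] prod.permute[OF \<sigma>(2), of "\<lambda>i. gB i y"] by (simp_all add: o_def)
    ultimately show ?thesis by (simp add: product_seq_def prod.distrib)
  qed
  ultimately show ?thesis unfolding bicompatible_def by blast
qed

text \<open>As a function of the first pair, a product sequence is a scalar multiple of
  \<open>ev_tensor KA KB x y\<close>, which \<open>F\<close> sends to 0.\<close>

lemma f_tensor_id_product_seq:
  assumes F: "linear_on_forms KA KB F" and zero: "F (ev_tensor KA KB x y) = 0" and n: "n \<ge> 1"
  shows "f_tensor_id F (reorder_S (product_seq KA KB x y n)) = (\<lambda>_. 0)"
proof
  fix p
  define c where "c = (if \<forall>i\<in>{1..<n}. fst (p i) \<in> AK KA \<and> snd (p i) \<in> AK KB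
    then \<Prod>i\<in>{1..<n}. fst (p i) x * snd (p i) y else 0)"
  have v: "valid_args KA KB n (fst \<circ> p(0 := (g, h))) (snd \<circ> p(0 := (g, h))) \<longleftrightarrow>
      (g \<in> AK KA \<and> h \<in> AK KB) \<and> (\<forall>i\<in>{1..<n}. fst (p i) \<in> AK KA \<and> snd (p i) \<in> AK KB)" for g h
    using n by (fastforce simp: valid_args_def)
  have "reorder_S (product_seq KA KB x y n) (p(0 := (g, h))) = c * ev_tensor KA KB x y g h" for g h
  proof -
    have "{..<n} = insert 0 {1..<n}" using n by auto
    then have "(\<Prod>i<n. (fst \<circ> p(0 := (g, h))) i x * (snd \<circ> p(0 := (g, h))) i y)
        = g x * h y * (\<Prod>i\<in>{1..<n}. fst (p i) x * snd (p i) y)"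
      by simp
    then show ?thesis unfolding reorder_S_def product_seq_def v by (simp add: c_def ev_tensor_def)
  qed
  \<comment> \<open>The sum over a singleton brings the scalar into the form in which
    \<open>linear_on_forms_sum\<close> pulls it out.\<close>
  then have "f_tensor_id F (reorder_S (product_seq KA KB x y n)) p = F (\<lambda>g h. \<Sum>i\<in>{()}. c * ev_tensor KA KB x y g h)"
    by (simp add: f_tensor_id_def)
  also have "\<dots> = (\<Sum>i\<in>{()}. c *\<^sub>R F (ev_tensor KA KB x y))"
    by (intro linear_on_forms_sum[OF F]) (auto simp: ev_tensor_in_bilin_forms)
  finally show "f_tensor_id F (reorder_S (product_seq KA KB x y n)) p = 0" using zero by simp
qed

section \<open>Zeros from bicompatible sequences\<close>

lemma bicompatible_imp_zero:
  fixes KA :: "'a::euclidean_space set" and KB :: "'b::euclidean_space set"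
    and F :: "(('a \<Rightarrow> real) \<Rightarrow> ('b \<Rightarrow> real) \<Rightarrow> real) \<Rightarrow> 'v::euclidean_space"
  assumes K: "compact KA" "convex KA" "compact KB" "convex KB"
    and F: "linear_on_forms KA KB F" and Y: "bicompatible KA KB Y"
    and n: "n \<ge> 2" and zero: "f_tensor_id F (reorder_S (Y n)) = (\<lambda>_. 0)"
  shows "\<exists>x\<in>KA. \<exists>y\<in>KB. F (ev_tensor KA KB x y) = 0"
proof -
  note cv = K(2,4)
  obtain E \<gamma> where E: "finite E" "E \<subseteq> AK KA" "\<forall>e\<in>E. \<forall>x\<in>KA. 1/4 \<le> e x \<and> e x \<le> 3/4"
    and \<gamma>: "\<forall>e. AK_linear KA (\<gamma> e)" "\<forall>g\<in>AK KA. g = (\<lambda>x. \<Sum>e\<in>E. \<gamma> e g * e x)"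
    by (rule AK_frame[OF K(1,2)])
  obtain D \<delta> where D: "finite D" "D \<subseteq> AK KB" "\<forall>d\<in>D. \<forall>y\<in>KB. 1/4 \<le> d y \<and> d y \<le> 3/4"
    and \<delta>: "\<forall>d. AK_linear KB (\<delta> d)" "\<forall>h\<in>AK KB. h = (\<lambda>y. \<Sum>d\<in>D. \<delta> d h * d y)"
    by (rule AK_frame[OF K(3,4)])
  obtain v where "\<forall>\<phi>\<in>bilin_forms KA KB. F \<phi> = (\<Sum>p\<in>E \<times> D. \<phi> (fst p) (snd p) *\<^sub>R v p)"
    by (rule linear_on_forms_expand[OF F E(1,2) \<gamma> D(1,2) \<delta>])
  then have v: "F \<phi> = (\<Sum>p\<in>E \<times> D. \<phi> (fst p) (snd p) *\<^sub>R v p)" if "\<phi> \<in> bilin_forms KA KB" for \<phi>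
    using that by blast
  define N where "N = E \<times> D"
  define f where "f = (\<lambda>z. \<Sum>p\<in>N. (fst p (fst z) * snd p (snd z)) *\<^sub>R v p)"
  have Ff: "F (ev_tensor KA KB x y) = f (x, y)" for x y
    unfolding v[OF ev_tensor_in_bilin_forms] f_def N_def
    using E(2) D(2) by (intro sum.cong) (auto simp: ev_tensor_def)
  have N: "fst p \<in> AK KA" "snd p \<in> AK KB" if "p \<in> N" for p using that E(2) D(2) by (auto simp: N_def)
  have cont: "continuous_on (KA \<times> KB) f"
    unfolding f_def
  proof (intro continuous_intros)
    fix p assume p: "p \<in> N"
    show "continuous_on (KA \<times> KB) (\<lambda>z. fst p (fst z))"
      by (rule continuous_on_compose2[OF AK_continuous_on[OF cv(1) N(1)[OF p]] continuous_on_fst[OF continuous_on_id]]) auto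
    show "continuous_on (KA \<times> KB) (\<lambda>z. snd p (snd z))"
      by (rule continuous_on_compose2[OF AK_continuous_on[OF cv(2) N(2)[OF p]] continuous_on_snd[OF continuous_on_id]]) auto
  qed
  \<comment> \<open>The Gram matrix of the coefficients of \<open>F\<close>: these are the
    coefficients of the squared norm of \<open>f\<close> in terms of the frames.\<close>
  define c where "c = (\<lambda>p q. v p \<bullet> v q)"
  \<comment> \<open>For fixed \<open>q\<close>, summing over \<open>p\<close> rebuilds
    \<open>F\<close> applied to the first pair, which is 0 by the assumed equation.\<close>
  have "(\<Sum>p\<in>N. \<Sum>q\<in>N. c p q * mom Y p q) = (\<Sum>q\<in>N. (\<Sum>p\<in>N. mom Y p q *\<^sub>R v p) \<bullet> v q)"
    by (subst sum.swap) (simp add: c_def inner_sum_left mult.commute)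
  also have "\<dots> = 0"
  proof (rule sum.neutral, rule ballI)
    fix q assume "q \<in> N"
    then have q: "q \<in> AK KA \<times> AK KB" using N by (auto simp: mem_Times_iff)
    have "(\<Sum>p\<in>N. mom Y p q *\<^sub>R v p) = F (\<lambda>g h. mom Y (g, h) q)"
      using v[OF mom_in_bilin_forms[OF Y q]] by (simp add: N_def)
    then show "(\<Sum>p\<in>N. mom Y p q *\<^sub>R v p) \<bullet> v q = 0"
      using f_tensor_id_zero_imp[OF Y cv F n zero q] by simp
  qed
  finally have sum0: "(\<Sum>p\<in>N. \<Sum>q\<in>N. c p q * mom Y p q) = 0" .
  \<comment> \<open>On product states the quadratic expression is the squared norm of
    \<open>f\<close> itself, so the comparison with \<open>Y\<close> makes it arbitrarily
    small.\<close>
  have norm_f: "(norm (f z))\<^sup>2 = (\<Sum>p\<in>N. \<Sum>q\<in>N. c p q * ((fst p (fst z) * snd p (snd z)) * (fst q (fst z) * snd q (snd z))))" for z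
    unfolding power2_norm_eq_inner f_def c_def by (simp add: inner_sum_left inner_sum_right sum_distrib_left mult_ac inner_commute)
  have small: "\<exists>z\<in>KA \<times> KB. (norm (f z))\<^sup>2 \<le> \<epsilon>" if \<epsilon>: "\<epsilon> > 0" for \<epsilon>
  proof -
    obtain x y where xy: "x \<in> KA" "y \<in> KB"
      "(\<Sum>p\<in>N. \<Sum>q\<in>N. c p q * ((fst p x * snd p y) * (fst q x * snd q y)))
        \<le> (\<Sum>p\<in>N. \<Sum>q\<in>N. c p q * mom Y p q) + \<epsilon>"
      unfolding N_def by (rule product_state_le_bicompatible[OF Y K E D \<epsilon>, of c])
    then have "(norm (f (x, y)))\<^sup>2 \<le> \<epsilon>" unfolding norm_f sum0 by simp
    then show ?thesis using xy by blast
  qed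
  have "KA \<times> KB \<noteq> {}" using small[of 1] by auto
  moreover have "compact (KA \<times> KB)" using K by (intro compact_Times)
  moreover have "continuous_on (KA \<times> KB) (\<lambda>z. (norm (f z))\<^sup>2)" using cont by (intro continuous_intros)
  ultimately obtain z where z: "z \<in> KA \<times> KB" "\<And>w. w \<in> KA \<times> KB \<Longrightarrow> (norm (f z))\<^sup>2 \<le> (norm (f w))\<^sup>2"
    using continuous_attains_inf[of "KA \<times> KB"] by metis
  have "(norm (f z))\<^sup>2 \<le> \<epsilon>" if "\<epsilon> > 0" for \<epsilon> using small[OF that] z(2) by (meson order_trans)
  then have "(norm (f z))\<^sup>2 \<le> 0" by (rule field_le_epsilon) simp
  then have "f z = 0" by simp
  then show ?thesis using z(1) Ff by (metis mem_Times_iff prod.collapse)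
qed

theorem theorem2:
  fixes KA :: "'a::euclidean_space set" and KB :: "'b::euclidean_space set"
    and f :: "'a \<Rightarrow> 'b \<Rightarrow> 'v::euclidean_space"
    and F :: "(('a \<Rightarrow> real) \<Rightarrow> ('b \<Rightarrow> real) \<Rightarrow> real) \<Rightarrow> 'v"
  assumes "compact KA" and "convex KA" and "compact KB" and "convex KB"
    and "\<forall>y\<in>KB. \<forall>x\<in>KA. \<forall>x'\<in>KA. \<forall>t::real. 0 \<le> t \<and> t \<le> 1 \<longrightarrow>
           f ((1 - t) *\<^sub>R x + t *\<^sub>R x') y = (1 - t) *\<^sub>R f x y + t *\<^sub>R f x' y"
    and "\<forall>x\<in>KA. \<forall>y\<in>KB. \<forall>y'\<in>KB. \<forall>t::real. 0 \<le> t \<and> t \<le> 1 \<longrightarrow>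
           f x ((1 - t) *\<^sub>R y + t *\<^sub>R y') = (1 - t) *\<^sub>R f x y + t *\<^sub>R f x y'"
    and "linear_on_forms KA KB F"
    and "\<forall>x\<in>KA. \<forall>y\<in>KB. F (ev_tensor KA KB x y) = f x y"
  shows "((\<exists>x\<in>KA. \<exists>y\<in>KB. f x y = 0) \<longleftrightarrow>
          (\<exists>Y. bicompatible KA KB Y \<and>
             (\<exists>n\<ge>2. f_tensor_id F (reorder_S (Y n)) = (\<lambda>_. 0)))) \<and>
         ((\<exists>x\<in>KA. \<exists>y\<in>KB. f x y = 0) \<longrightarrow>
          (\<exists>Y. bicompatible KA KB Y \<and>
             (\<forall>n\<ge>2. f_tensor_id F (reorder_S (Y n)) = (\<lambda>_. 0))))"
proof -
  \<comment> \<open>A single product sequence serves every \<open>n\<close>, which yields the last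
    claim and, at \<open>n = 2\<close>, the implication from (i) to (ii).\<close>
  have all: "\<exists>Y. bicompatible KA KB Y \<and> (\<forall>n\<ge>2. f_tensor_id F (reorder_S (Y n)) = (\<lambda>_. 0))"
    if zero: "\<exists>x\<in>KA. \<exists>y\<in>KB. f x y = 0"
  proof -
    obtain x y where xy: "x \<in> KA" "y \<in> KB" "F (ev_tensor KA KB x y) = 0" using zero assms(8) by metis
    show ?thesis
      using bicompatible_product_seq[OF xy(1,2) assms(2,4)] f_tensor_id_product_seq[OF assms(7) xy(3)]
      by (intro exI[of _ "product_seq KA KB x y"]) auto
  qed
  moreover have "\<exists>x\<in>KA. \<exists>y\<in>KB. f x y = 0"
    if "bicompatible KA KB Y" "n \<ge> 2" "f_tensor_id F (reorder_S (Y n)) = (\<lambda>_. 0)" for Y n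
    using bicompatible_imp_zero[OF assms(1-4,7) that] assms(8) by auto
  ultimately show ?thesis by blast
qed

end
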